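(* There exist distributional solutions $H^{\mathbf r}$ and $H^{\mathbf s}$, both supported in the light cone $\mathcal K=\{(\nu,s):|s|\le k(\nu)\}$, of the initial value problems in $(0,\nu_{\rm cr})\times\mathbb R$: $$\begin{cases}H^{\mathbf r}_{\nu\nu}-\frac{M^2-1}{\varrho^2}H^{\mathbf r}_{ss}=0,\\ H^{\mathbf r}|_{\nu=0}=0,\\ H^{\mathbf r}_\nu|_{\nu=0}=\delta_0,\end{cases}\qquad \begin{cases}H^{\mathbf s}_{\nu\nu}-\frac{M^2-1}{\varrho^2}H^{\mathbf s}_{ss}=0,\\ H^{\mathbf s}|_{\nu=0}=\delta_0,\\ \varrho H^{\mathbf s}_\nu|_{\nu=0}=-\delta_0'',\end{cases}$$ where the initial conditions are understood as limits as $\nu\to0^+$ (in the sense of distributions in $s$).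
   Context: Standing setting ($\gamma=3$): $\varrho=\sqrt{1-q^2}$ is the density for speed $q\in[0,1]$, $M=q/\varrho$ the Mach number; the renormalized density is $\nu(\varrho)=\int_0^\varrho\frac{\tau^2}{1-\tau^2}d\tau$, with inverse $\varrho(\nu)$, and $\nu_{\rm cr}=\nu(1/\sqrt2)$ (sonic, $M=1$). The characteristic speed $k$ on $[0,\nu_{\rm cr}]$ satisfies $k(0)=0$, $k'(\nu)=\sqrt{1-2\varrho(\nu)^2}/\varrho(\nu)^2$, so $k'^2=(M^2-1)/\varrho^2$. $\delta_0$ is the Dirac mass at $0$. *)

theory Defs
  imports "HOL-Analysis.Analysis"
begin

section \<open>Gas-dynamic quantities (gamma = 3)\<close>

definition nu_of_rho :: "real \<Rightarrow> real" where
  "nu_of_rho r = integral {0..r} (\<lambda>\<tau>. \<tau>^2 / (1 - \<tau>^2))"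

definition rho :: "real \<Rightarrow> real" where
  "rho v = (THE r. 0 \<le> r \<and> r < 1 \<and> nu_of_rho r = v)"

text \<open>Sonic value nu_cr = nu(1/sqrt 2).\<close>
definition nu_cr :: real where
  "nu_cr = nu_of_rho (1 / sqrt 2)"

text \<open>Speed q = sqrt(1 - rho^2) and Mach number M = q / rho as functions of nu.\<close>
definition mach :: "real \<Rightarrow> real" where
  "mach v = sqrt (1 - (rho v)^2) / rho v"

definition wave_coef :: "real \<Rightarrow> real" where
  "wave_coef v = ((mach v)^2 - 1) / (rho v)^2"

definition kspeed :: "real \<Rightarrow> real" where
  "kspeed v = integral {0..v} (\<lambda>\<mu>. sqrt (1 - 2 * (rho \<mu>)^2) / (rho \<mu>)^2)"

definition test_fun :: "(real \<Rightarrow> real) \<Rightarrow> bool" where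
  "test_fun \<psi> \<longleftrightarrow> (\<forall>n x. ((deriv ^^ n) \<psi>) differentiable (at x))
                    \<and> (\<exists>R. \<forall>x. R < \<bar>x\<bar> \<longrightarrow> \<psi> x = 0)"

definition distribution :: "((real \<Rightarrow> real) \<Rightarrow> real) \<Rightarrow> bool" where
  "distribution T \<longleftrightarrow>
     (\<forall>\<psi> \<phi> a b. test_fun \<psi> \<longrightarrow> test_fun \<phi> \<longrightarrow>
        T (\<lambda>x. a * \<psi> x + b * \<phi> x) = a * T \<psi> + b * T \<phi>) \<and>
     (\<forall>R. \<exists>C N. \<forall>\<psi>. test_fun \<psi> \<and> (\<forall>x. R < \<bar>x\<bar> \<longrightarrow> \<psi> x = 0) \<longrightarrow>
        \<bar>T \<psi>\<bar> \<le> C * (\<Sum>j\<le>N. Sup (range (\<lambda>x. \<bar>(deriv ^^ j) \<psi> x\<bar>))))"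

definition supp_in :: "((real \<Rightarrow> real) \<Rightarrow> real) \<Rightarrow> real set \<Rightarrow> bool" where
  "supp_in T F \<longleftrightarrow> (\<forall>\<psi>. test_fun \<psi> \<and> closure {x. \<psi> x \<noteq> 0} \<inter> F = {} \<longrightarrow> T \<psi> = 0)"

text \<open>H is represented as a family nu |-> H(nu,.) of distributions in s, nu in (0, nu_cr).
  It solves H_nu nu - (M^2-1)/rho^2 H_ss = 0 in the sense of distributions in s, twice
  differentiable in nu, and H(nu,.) is supported in [-k(nu), k(nu)] (light cone K).\<close>
definition cone_wave_solution :: "(real \<Rightarrow> (real \<Rightarrow> real) \<Rightarrow> real) \<Rightarrow> bool" where
  "cone_wave_solution H \<longleftrightarrow>
     (\<forall>v\<in>{0<..<nu_cr}. distribution (H v) \<and> supp_in (H v) {- kspeed v .. kspeed v}) \<and>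
     (\<forall>\<psi>. test_fun \<psi> \<longrightarrow>
        (\<forall>v\<in>{0<..<nu_cr}.
           (\<lambda>\<mu>. H \<mu> \<psi>) differentiable (at v) \<and>
           (deriv (\<lambda>\<mu>. H \<mu> \<psi>)) differentiable (at v) \<and>
           deriv (deriv (\<lambda>\<mu>. H \<mu> \<psi>)) v - wave_coef v * H v (deriv (deriv \<psi>)) = 0))"

end

theory Submission
  imports Defs
begin

text \<open>
  In the characteristic time \<open>t = k(\<nu>)\<close> put \<open>p = (k')\<^sup>-\<^sup>1\<^sup>/\<^sup>2\<close>. The quantity \<open>v = p H\<^sub>\<nu>\<close> solves
  \<open>v\<^sub>t\<^sub>t = v\<^sub>s\<^sub>s + q v\<close> with \<open>q = p'' / p\<close>. This is the Darboux transform of the \<open>H\<close>-equation by its static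
  solution 1, and it removes the singularity at \<open>t = 0\<close>: the potential \<open>2 / t\<^sup>2\<close> of the Liouville normal form
  becomes \<open>q = (1 - \<rho>\<^sup>2)\<^sup>2 (3 + \<rho>\<^sup>2) / (1 - 2 \<rho>\<^sup>2)\<^sup>3\<close>, which is continuous up to \<open>t = 0\<close>. Hence \<open>v\<close>, tested
  against \<open>\<psi>\<close>, is given by a Picard series over d'Alembert's formula with finite speed of propagation, and
  \<open>H = c + \<integral>\<^sub>0\<^sup>t p v\<close>. The Wronskian \<open>p v\<^sub>t - p\<^sub>t v\<close> has derivative \<open>p v\<^sub>s\<^sub>s\<close>, which turns \<open>H\<^sub>\<nu> = v / p\<close> into the
  wave equation for \<open>H\<close>, provided \<open>c\<close> applied to \<open>\<psi>''\<close> is \<open>- v\<close> at \<open>t = 0\<close>. The regular solution has \<open>v = 0\<close>,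
  \<open>v\<^sub>t = \<delta>\<^sub>0\<close>, \<open>c = 0\<close> and the singular one \<open>v = - \<delta>\<^sub>0''\<close>, \<open>v\<^sub>t = 0\<close>, \<open>c = \<delta>\<^sub>0\<close> initially.
\<close>

section \<open>The Duhamel operator on the strip\<close>

definition strip_cont :: "real \<Rightarrow> (real \<Rightarrow> real \<Rightarrow> real) \<Rightarrow> bool" where
  "strip_cont T f \<longleftrightarrow> continuous_on ({0..T} \<times> UNIV) (\<lambda>(t, x). f t x)"

lemma strip_contI:
  "continuous_on ({0..T} \<times> UNIV) (\<lambda>w. f (fst w) (snd w)) \<Longrightarrow> strip_cont T f"
  by (simp add: strip_cont_def case_prod_beta)

lemma strip_cont_compose:
  assumes "strip_cont T f" "continuous_on S g" "continuous_on S h"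
    and "\<And>s. s \<in> S \<Longrightarrow> 0 \<le> g s" "\<And>s. s \<in> S \<Longrightarrow> g s \<le> T"
  shows "continuous_on S (\<lambda>s. f (g s) (h s))"
proof -
  have "continuous_on S (\<lambda>s. (g s, h s))"
    by (intro continuous_intros assms(2,3))
  moreover have "(\<lambda>s. (g s, h s)) ` S \<subseteq> {0..T} \<times> UNIV"
    using assms(4,5) by auto
  ultimately show ?thesis
    using continuous_on_compose2[OF assms(1)[unfolded strip_cont_def]] by fastforce
qed

text \<open>
  \<open>duhamel q f t x\<close> is the usual integral of \<open>q f / 2\<close> over the backward triangle with apex \<open>(t, x)\<close>,
  rescaled to the fixed box \<open>\<theta> \<in> [0, 1]\<close>, \<open>z \<in> [-1, 1]\<close>.
\<close>

definition mean :: "(real \<Rightarrow> real \<Rightarrow> real) \<Rightarrow> real \<Rightarrow> real \<Rightarrow> real \<Rightarrow> real" where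
  "mean f t a x = integral {-1..1} (\<lambda>z. f t (x + a * z)) / 2"

definition duhamel ::
  "(real \<Rightarrow> real) \<Rightarrow> (real \<Rightarrow> real \<Rightarrow> real) \<Rightarrow> real \<Rightarrow> real \<Rightarrow> real" where
  "duhamel q f t x = integral {0..1}
     (\<lambda>\<theta>. t * (q (t * \<theta>) * (t * (1 - \<theta>) * mean f (t * \<theta>) (t * (1 - \<theta>)) x)))"

text \<open>Neumann series of the Volterra equation \<open>u = f + duhamel q u\<close>. For a smooth
  \<open>f\<close> solving the free wave equation, this \<open>u\<close> solves
  \<open>u_tt = u_xx + q u\<close> with the initial data of \<open>f\<close>.\<close>

definition wave_sol ::
  "(real \<Rightarrow> real) \<Rightarrow> (real \<Rightarrow> real \<Rightarrow> real) \<Rightarrow> real \<Rightarrow> real \<Rightarrow> real" where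
  "wave_sol q f t x = (\<Sum>n. (duhamel q ^^ n) f t x)"

section \<open>Continuity, linearity and bounds of the Duhamel operator\<close>

lemma continuous_on_mean:
  assumes f: "strip_cont T f" and "continuous_on S g" "continuous_on S a" "continuous_on S h"
    and "\<And>s. s \<in> S \<Longrightarrow> 0 \<le> g s" "\<And>s. s \<in> S \<Longrightarrow> g s \<le> T"
  shows "continuous_on S (\<lambda>s. mean f (g s) (a s) (h s))"
proof -
  have "continuous_on (S \<times> cbox (-1) 1) (\<lambda>w. f (g (fst w)) (h (fst w) + a (fst w) * snd w))"
    using assms
    by (intro strip_cont_compose[OF f] continuous_intros
        continuous_on_compose2[where f = fst]) auto
  then have "continuous_on S (\<lambda>s. integral (cbox (-1) 1) (\<lambda>z. f (g s) (h s + a s * z)))"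
    by (intro integral_continuous_on_param) (simp add: case_prod_beta)
  then show ?thesis
    unfolding mean_def by (auto intro!: continuous_intros)
qed

lemma scaled_time_bounds:
  fixes t \<theta> T :: real
  assumes "0 \<le> t" "t \<le> T" "0 \<le> \<theta>" "\<theta> \<le> 1"
  shows "0 \<le> t * \<theta>" "t * \<theta> \<le> T"
proof -
  have "t * \<theta> \<le> t * 1" using assms by (intro mult_left_mono) auto
  then show "0 \<le> t * \<theta>" "t * \<theta> \<le> T" using assms by auto
qed

text \<open>After the rescaling the domain of integration no longer depends on
  \<open>(t, x)\<close>, so continuity of integrals in a parameter applies, with no special case at
  \<open>t = 0\<close>.\<close>

lemma strip_cont_duhamel:
  assumes q: "continuous_on {0..T} q" and f: "strip_cont T f"
  shows "strip_cont T (duhamel q f)"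
proof -
  have "continuous_on (({0..T} \<times> UNIV) \<times> cbox 0 1)
     (\<lambda>w. fst (fst w) * (q (fst (fst w) * snd w) * (fst (fst w) * (1 - snd w) *
        mean f (fst (fst w) * snd w) (fst (fst w) * (1 - snd w)) (snd (fst w)))))"
    by (intro continuous_intros continuous_on_mean[OF f]
        continuous_on_compose2[OF q, where f = "\<lambda>w. fst (fst w) * snd w"])
      (auto intro: scaled_time_bounds)
  then have "continuous_on ({0..T} \<times> UNIV) (\<lambda>w. integral (cbox 0 1) (\<lambda>\<theta>. fst w * (q (fst w * \<theta>) *
      (fst w * (1 - \<theta>) * mean f (fst w * \<theta>) (fst w * (1 - \<theta>)) (snd w)))))"
    by (intro integral_continuous_on_param) (simp add: case_prod_beta)
  then show ?thesis
    by (intro strip_contI) (simp add: duhamel_def)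
qed

lemma continuous_on_duhamel_integrand:
  assumes q: "continuous_on {0..T} q" and f: "strip_cont T f" and "0 \<le> t" "t \<le> T"
  shows "continuous_on {0..1}
     (\<lambda>\<theta>. t * (q (t * \<theta>) * (t * (1 - \<theta>) * mean f (t * \<theta>) (t * (1 - \<theta>)) x)))"
  by (intro continuous_intros continuous_on_mean[OF f]
        continuous_on_compose2[OF q, where f = "\<lambda>\<theta>. t * \<theta>"])
      (use assms in \<open>auto intro: scaled_time_bounds\<close>)

lemma continuous_on_strip_slice:
  assumes "strip_cont T f" "0 \<le> t" "t \<le> T" "continuous_on S h"
  shows "continuous_on S (\<lambda>z. f t (h z))"
  using assms by (intro strip_cont_compose[OF assms(1)] continuous_intros) auto

lemma mean_add_cmult:
  assumes f: "strip_cont T f" and g: "strip_cont T g" and t: "0 \<le> t" "t \<le> T"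
  shows "mean (\<lambda>t x. a * f t x + b * g t x) t r x = a * mean f t r x + b * mean g t r x"
proof -
  have "(\<lambda>z. f t (x + r * z)) integrable_on {-1..1}" "(\<lambda>z. g t (x + r * z)) integrable_on {-1..1}"
    by (intro integrable_continuous_real continuous_on_strip_slice[OF f t]
        continuous_on_strip_slice[OF g t] continuous_intros)+
  then show ?thesis
    unfolding mean_def by (simp add: integral_add integrable_on_mult_right field_simps)
qed

lemma duhamel_add_cmult:
  assumes q: "continuous_on {0..T} q" and f: "strip_cont T f" and g: "strip_cont T g"
    and t: "0 \<le> t" "t \<le> T"
  shows "duhamel q (\<lambda>t x. a * f t x + b * g t x) t x = a * duhamel q f t x + b * duhamel q g t x"
proof -
  let ?k = "\<lambda>f \<theta>. t * (q (t * \<theta>) * (t * (1 - \<theta>) * mean f (t * \<theta>) (t * (1 - \<theta>)) x))"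
  have int: "?k f integrable_on {0..1}" "?k g integrable_on {0..1}"
    by (intro integrable_continuous_real continuous_on_duhamel_integrand[OF q _ t] f g)+
  have "duhamel q (\<lambda>t x. a * f t x + b * g t x) t x
      = integral {0..1} (\<lambda>\<theta>. a * ?k f \<theta> + b * ?k g \<theta>)"
    unfolding duhamel_def
  proof (rule integral_cong)
    fix \<theta> :: real assume "\<theta> \<in> {0..1}"
    then have "0 \<le> t * \<theta>" "t * \<theta> \<le> T" using scaled_time_bounds[OF t] by auto
    note eq = mean_add_cmult[OF f g this]
    show "t * (q (t * \<theta>) * (t * (1 - \<theta>) *
          mean (\<lambda>t x. a * f t x + b * g t x) (t * \<theta>) (t * (1 - \<theta>)) x))
        = a * ?k f \<theta> + b * ?k g \<theta>"
      unfolding eq by (simp add: algebra_simps)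
  qed
  also have "\<dots> = a * duhamel q f t x + b * duhamel q g t x"
    unfolding duhamel_def using int
    by (subst integral_add) (auto intro!: integrable_on_mult_right)
  finally show ?thesis .
qed

lemma duhamel_cong:
  assumes "\<And>t x. 0 \<le> t \<Longrightarrow> t \<le> T \<Longrightarrow> f t x = g t x" "0 \<le> t" "t \<le> T"
  shows "duhamel q f t x = duhamel q g t x"
proof -
  have "mean f (t * \<theta>) a x = mean g (t * \<theta>) a x" if "\<theta> \<in> {0..1}" for \<theta> a
    using that scaled_time_bounds[OF assms(2,3)] by (simp add: mean_def assms(1))
  then show ?thesis
    unfolding duhamel_def by (intro integral_cong) simp
qed

lemma abs_mean_le:
  assumes f: "strip_cont T f" and t: "0 \<le> t" "t \<le> T" and b: "\<And>x. \<bar>f t x\<bar> \<le> b"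
  shows "\<bar>mean f t r x\<bar> \<le> b"
proof -
  have "norm (integral {-1..1} (\<lambda>z. f t (x + r * z))) \<le> b * (1 - (-1))"
    by (rule integral_bound) (auto intro!: continuous_on_strip_slice[OF f t] continuous_intros b)
  then show ?thesis unfolding mean_def by simp
qed

text \<open>Of the two factors of order \<open>t\<close>, one is kept and the other,
  \<open>t * (1 - \<theta>)\<close>, is only bounded by \<open>T\<close>. Integrating
  \<open>\<theta> ^ n\<close> yields the divisor \<open>Suc n\<close>; iteration builds up the
  factorial that makes the Picard series converge however large \<open>B\<close> and
  \<open>T\<close> are.\<close>

lemma abs_duhamel_le:
  assumes q: "continuous_on {0..T} q" and f: "strip_cont T f" and t: "0 \<le> t" "t \<le> T"
    and B: "\<And>t. 0 \<le> t \<Longrightarrow> t \<le> T \<Longrightarrow> \<bar>q t\<bar> \<le> B"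
    and b: "\<And>t x. 0 \<le> t \<Longrightarrow> t \<le> T \<Longrightarrow> \<bar>f t x\<bar> \<le> A * t ^ n"
  shows "\<bar>duhamel q f t x\<bar> \<le> A * (B * T) * t ^ Suc n / Suc n"
proof -
  let ?k = "\<lambda>\<theta>. t * (q (t * \<theta>) * (t * (1 - \<theta>) * mean f (t * \<theta>) (t * (1 - \<theta>)) x))"
  let ?C = "A * (B * T) * t ^ Suc n"
  have B0: "0 \<le> B" using B[of t] t by linarith
  have "((\<lambda>\<theta>::real. ?C * \<theta> ^ n) has_integral ?C * (1 ^ Suc n / Suc n - 0 ^ Suc n / Suc n)) {0..1}"
    by (intro has_integral_mult_right fundamental_theorem_of_calculus)
      (auto intro!: derivative_eq_intros simp flip: has_real_derivative_iff_has_vector_derivative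
        simp del: power_Suc)
  then have I: "((\<lambda>\<theta>::real. ?C * \<theta> ^ n) has_integral ?C / Suc n) {0..1}"
    by simp
  have "norm (integral {0..1} ?k) \<le> integral {0..1} (\<lambda>\<theta>. ?C * \<theta> ^ n)"
  proof (rule integral_norm_bound_integral)
    show "?k integrable_on {0..1}"
      by (intro integrable_continuous_real continuous_on_duhamel_integrand[OF q f t])
    show "(\<lambda>\<theta>. ?C * \<theta> ^ n) integrable_on {0..1}" using I by blast
    fix \<theta> :: real assume th: "\<theta> \<in> {0..1}"
    then have s: "0 \<le> t * \<theta>" "t * \<theta> \<le> T" using scaled_time_bounds[OF t] by auto
    have m: "\<bar>mean f (t * \<theta>) (t * (1 - \<theta>)) x\<bar> \<le> A * (t * \<theta>) ^ n"
      by (rule abs_mean_le[OF f s]) (rule b[OF s])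
    have t1: "t * (1 - \<theta>) \<le> T" "0 \<le> t * (1 - \<theta>)"
      using scaled_time_bounds[OF t, of "1 - \<theta>"] th by auto
    have "\<bar>q (t * \<theta>)\<bar> * (t * (1 - \<theta>) * \<bar>mean f (t * \<theta>) (t * (1 - \<theta>)) x\<bar>)
        \<le> B * (T * (A * (t * \<theta>) ^ n))"
      using t1 m B[OF s] B0 t by (intro mult_mono) auto
    then have "t * (\<bar>q (t * \<theta>)\<bar> * (t * (1 - \<theta>) * \<bar>mean f (t * \<theta>) (t * (1 - \<theta>)) x\<bar>))
        \<le> t * (B * (T * (A * (t * \<theta>) ^ n)))"
      using t by (intro mult_left_mono) auto
    then show "norm (?k \<theta>) \<le> ?C * \<theta> ^ n"
      using t1 t th by (simp add: abs_mult power_mult_distrib mult_ac)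
  qed
  then show ?thesis
    unfolding duhamel_def integral_unique[OF I] real_norm_def by simp
qed

lemma has_real_derivative_mean:
  assumes f: "strip_cont T f" and f': "strip_cont T f'"
    and der: "\<And>x. (f t has_real_derivative f' t x) (at x)" and t: "0 \<le> t" "t \<le> T"
  shows "((\<lambda>x. mean f t r x) has_real_derivative mean f' t r x) (at x)"
proof -
  have "((\<lambda>x. integral (cbox (-1) 1) (\<lambda>z. f t (x + r * z))) has_real_derivative
      integral (cbox (-1) 1) (\<lambda>z. f' t (x + r * z))) (at x within UNIV)"
  proof (rule leibniz_rule_field_derivative)
    fix x z :: real
    show "((\<lambda>x. f t (x + r * z)) has_real_derivative f' t (x + r * z)) (at x within UNIV)"
      using DERIV_shift[of "f t" "f' t (x + r * z)" x "r * z"] der by simp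
  next
    fix x show "(\<lambda>z. f t (x + r * z)) integrable_on cbox (-1) 1"
      by (intro integrable_continuous continuous_on_strip_slice[OF f t] continuous_intros)
  next
    show "continuous_on (UNIV \<times> cbox (-1) 1) (\<lambda>(x, z). f' t (x + r * z))"
      unfolding case_prod_beta
      by (intro continuous_on_strip_slice[OF f' t] continuous_intros)
  qed simp_all
  from DERIV_cdivide[OF this, of 2] show ?thesis
    unfolding mean_def box_real .
qed

text \<open>The variable \<open>x\<close> enters only as a translation of \<open>f\<close>, and
  \<open>q\<close> depends on time alone, so differentiation passes onto \<open>f\<close> under both
  integrals.\<close>

lemma has_real_derivative_duhamel:
  assumes q: "continuous_on {0..T} q" and f: "strip_cont T f" and f': "strip_cont T f'"
    and der: "\<And>t x. 0 \<le> t \<Longrightarrow> t \<le> T \<Longrightarrow> (f t has_real_derivative f' t x) (at x)"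
    and t: "0 \<le> t" "t \<le> T"
  shows "(duhamel q f t has_real_derivative duhamel q f' t x) (at x)"
proof -
  let ?k = "\<lambda>f x \<theta>. t * (q (t * \<theta>) * (t * (1 - \<theta>) * mean f (t * \<theta>) (t * (1 - \<theta>)) x))"
  have "((\<lambda>x. integral (cbox 0 1) (?k f x)) has_real_derivative
      integral (cbox 0 1) (?k f' x)) (at x within UNIV)"
  proof (rule leibniz_rule_field_derivative)
    fix x \<theta> :: real assume "\<theta> \<in> cbox 0 1"
    then have "0 \<le> t * \<theta>" "t * \<theta> \<le> T" using scaled_time_bounds[OF t] by auto
    then show "((\<lambda>x. ?k f x \<theta>) has_real_derivative ?k f' x \<theta>) (at x within UNIV)"
      by (intro DERIV_cmult has_real_derivative_mean[OF f f'] der)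
  next
    fix x show "?k f x integrable_on cbox 0 1"
      using continuous_on_duhamel_integrand[OF q f t] by (intro integrable_continuous) simp
  next
    show "continuous_on (UNIV \<times> cbox 0 1) (\<lambda>(x, \<theta>). ?k f' x \<theta>)"
      unfolding case_prod_beta
      by (intro continuous_intros continuous_on_mean[OF f']
        continuous_on_compose2[OF q, where f = "\<lambda>w. t * snd w"])
      (use t in \<open>auto intro: scaled_time_bounds\<close>)
  qed simp_all
  moreover have "duhamel q f t = (\<lambda>x. integral (cbox 0 1) (?k f x))"
    by (rule ext) (simp add: duhamel_def)
  ultimately show ?thesis by (simp only: duhamel_def box_real)
qed

text \<open>Finite speed of propagation: the region \<open>s >= 0\<close>,
  \<open>s + |y| <= L\<close> contains the whole backward triangle of each of its points.\<close>

lemma duhamel_eq_0: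
  assumes z: "\<And>s y. 0 \<le> s \<Longrightarrow> s + \<bar>y\<bar> \<le> L \<Longrightarrow> f s y = 0"
    and t: "0 \<le> t" "t + \<bar>x\<bar> \<le> L"
  shows "duhamel q f t x = 0"
proof -
  have "mean f (t * \<theta>) (t * (1 - \<theta>)) x = 0" if th: "\<theta> \<in> {0..1}" for \<theta>
  proof -
    have "f (t * \<theta>) (x + t * (1 - \<theta>) * z) = 0" if "z \<in> {-1..1}" for z
    proof (rule z)
      have "t * (1 - \<theta>) * \<bar>z\<bar> \<le> t * (1 - \<theta>) * 1"
        using th t that by (intro mult_left_mono) auto
      then have "\<bar>x + t * (1 - \<theta>) * z\<bar> \<le> \<bar>x\<bar> + t * (1 - \<theta>)"
        using th t abs_triangle_ineq[of x "t * (1 - \<theta>) * z"] by (simp add: abs_mult)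
      then show "t * \<theta> + \<bar>x + t * (1 - \<theta>) * z\<bar> \<le> L"
        using t by (simp add: algebra_simps)
    qed (use th t in auto)
    then show ?thesis
      unfolding mean_def using integral_cong[of "{-1..1}" "\<lambda>z. f (t * \<theta>) (x + t * (1 - \<theta>) * z)" "\<lambda>_. 0"]
      by simp
  qed
  then show ?thesis
    unfolding duhamel_def
    using integral_cong[of "{0..1}" "\<lambda>\<theta>. t * (q (t * \<theta>) * (t * (1 - \<theta>) * mean f (t * \<theta>) (t * (1 - \<theta>)) x))" "\<lambda>_. 0"]
    by simp
qed

section \<open>Picard series for the wave equation with potential\<close>

lemma strip_cont_duhamel_funpow:
  assumes "continuous_on {0..T} q" "strip_cont T f"
  shows "strip_cont T ((duhamel q ^^ n) f)"
  by (induction n) (auto intro: strip_cont_duhamel assms)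

lemma abs_duhamel_funpow_le:
  assumes q: "continuous_on {0..T} q" and f: "strip_cont T f" and t: "0 \<le> t" "t \<le> T"
    and B: "\<And>t. 0 \<le> t \<Longrightarrow> t \<le> T \<Longrightarrow> \<bar>q t\<bar> \<le> B"
    and b: "\<And>t x. 0 \<le> t \<Longrightarrow> t \<le> T \<Longrightarrow> \<bar>f t x\<bar> \<le> A"
  shows "\<bar>(duhamel q ^^ n) f t x\<bar> \<le> A * ((B * T) ^ n / fact n) * t ^ n"
  using t
proof (induction n arbitrary: t x)
  case 0
  then show ?case using b by simp
next
  case (Suc n)
  have "\<bar>duhamel q ((duhamel q ^^ n) f) t x\<bar>
      \<le> A * ((B * T) ^ n / fact n) * (B * T) * t ^ Suc n / Suc n"
    by (rule abs_duhamel_le[OF q strip_cont_duhamel_funpow[OF q f] Suc.prems B]) (use Suc.IH in auto)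
  also have "\<dots> = A * ((B * T) ^ Suc n / fact (Suc n)) * t ^ Suc n"
    by (simp add: field_simps)
  finally show ?case by simp
qed

lemma duhamel_funpow_add_cmult:
  assumes q: "continuous_on {0..T} q" and f: "strip_cont T f" and g: "strip_cont T g"
    and t: "0 \<le> t" "t \<le> T"
  shows "(duhamel q ^^ n) (\<lambda>t x. a * f t x + b * g t x) t x
    = a * (duhamel q ^^ n) f t x + b * (duhamel q ^^ n) g t x"
  using t
proof (induction n arbitrary: t x)
  case (Suc n)
  have "duhamel q ((duhamel q ^^ n) (\<lambda>t x. a * f t x + b * g t x)) t x
    = duhamel q (\<lambda>t x. a * (duhamel q ^^ n) f t x + b * (duhamel q ^^ n) g t x) t x"
    by (rule duhamel_cong[OF Suc.IH Suc.prems])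
  also have "\<dots> = a * duhamel q ((duhamel q ^^ n) f) t x + b * duhamel q ((duhamel q ^^ n) g) t x"
    by (intro duhamel_add_cmult[OF q _ _ Suc.prems] strip_cont_duhamel_funpow q f g)
  finally show ?case by simp
qed simp

lemma has_real_derivative_duhamel_funpow:
  assumes q: "continuous_on {0..T} q" and f: "strip_cont T f" and f': "strip_cont T f'"
    and der: "\<And>t x. 0 \<le> t \<Longrightarrow> t \<le> T \<Longrightarrow> (f t has_real_derivative f' t x) (at x)"
    and t: "0 \<le> t" "t \<le> T"
  shows "((duhamel q ^^ n) f t has_real_derivative (duhamel q ^^ n) f' t x) (at x)"
  using t
proof (induction n arbitrary: t x)
  case (Suc n)
  show ?case
    using has_real_derivative_duhamel[OF q strip_cont_duhamel_funpow[OF q f, of n]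
        strip_cont_duhamel_funpow[OF q f', of n]] Suc by simp
qed (use der in simp)

lemma duhamel_funpow_eq_0:
  assumes z: "\<And>s y. 0 \<le> s \<Longrightarrow> s + \<bar>y\<bar> \<le> L \<Longrightarrow> f s y = 0"
    and t: "0 \<le> t" "t + \<bar>x\<bar> \<le> L"
  shows "(duhamel q ^^ n) f t x = 0"
  using t
proof (induction n arbitrary: t x)
  case (Suc n)
  then show ?case by (auto intro!: duhamel_eq_0[where L = L])
qed (use z in simp)

lemma wave_sol_eq_0:
  assumes "\<And>s y. 0 \<le> s \<Longrightarrow> s + \<bar>y\<bar> \<le> L \<Longrightarrow> f s y = 0" "0 \<le> t" "t + \<bar>x\<bar> \<le> L"
  shows "wave_sol q f t x = 0"
  using duhamel_funpow_eq_0[of L f t x _ q] assms by (simp add: wave_sol_def)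

section \<open>Convergence of the Picard series for a bounded potential\<close>

context
  fixes T B :: real and q :: "real \<Rightarrow> real"
  assumes q: "continuous_on {0..T} q" and B: "\<And>t. 0 \<le> t \<Longrightarrow> t \<le> T \<Longrightarrow> \<bar>q t\<bar> \<le> B"
begin

text \<open>Trading \<open>t ^ n\<close> for \<open>T ^ n\<close> makes the bound independent of
  \<open>(t, x)\<close>. What remains are the terms of an exponential series, the majorants for all
  convergence statements below.\<close>

lemma abs_duhamel_funpow_le_uniform:
  assumes f: "strip_cont T f" and b: "\<And>t x. 0 \<le> t \<Longrightarrow> t \<le> T \<Longrightarrow> \<bar>f t x\<bar> \<le> A"
    and t: "0 \<le> t" "t \<le> T"
  shows "\<bar>(duhamel q ^^ n) f t x\<bar> \<le> A * ((B * T * T) ^ n / fact n)"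
proof -
  have "0 \<le> A" "0 \<le> B" "0 \<le> T" using b[OF t, of 0] B[OF t] t by linarith+
  then have "A * ((B * T) ^ n / fact n) * t ^ n \<le> A * ((B * T) ^ n / fact n) * T ^ n"
    using t by (intro mult_left_mono power_mono) auto
  also have "\<dots> = A * ((B * T * T) ^ n / fact n)"
    by (simp add: power_mult_distrib)
  finally show ?thesis
    using abs_duhamel_funpow_le[OF q f t B b, of n x] by linarith
qed

lemma sums_exp_bound: "(\<lambda>n. A * ((B * T * T) ^ n / fact n)) sums (A * exp (B * T * T))"
  using sums_mult[OF exp_converges[of "B * T * T"], of A] by (simp add: divide_inverse mult_ac)

lemma summable_wave_sol:
  assumes f: "strip_cont T f" and b: "\<And>t x. 0 \<le> t \<Longrightarrow> t \<le> T \<Longrightarrow> \<bar>f t x\<bar> \<le> A"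
    and t: "0 \<le> t" "t \<le> T"
  shows "summable (\<lambda>n. (duhamel q ^^ n) f t x)"
  using abs_duhamel_funpow_le_uniform[OF f b t]
  by (intro summable_comparison_test'[OF sums_summable[OF sums_exp_bound[of A]]]) auto

lemma abs_wave_sol_le:
  assumes f: "strip_cont T f" and b: "\<And>t x. 0 \<le> t \<Longrightarrow> t \<le> T \<Longrightarrow> \<bar>f t x\<bar> \<le> A"
    and t: "0 \<le> t" "t \<le> T"
  shows "\<bar>wave_sol q f t x\<bar> \<le> A * exp (B * T * T)"
  using abs_duhamel_funpow_le_uniform[OF f b t] sums_exp_bound[of A]
    norm_suminf_le[of "\<lambda>n. (duhamel q ^^ n) f t x" "\<lambda>n. A * ((B * T * T) ^ n / fact n)"]
  by (simp add: wave_sol_def sums_iff)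

lemma uniform_limit_wave_sol:
  assumes f: "strip_cont T f" and b: "\<And>t x. 0 \<le> t \<Longrightarrow> t \<le> T \<Longrightarrow> \<bar>f t x\<bar> \<le> A"
  shows "uniform_limit ({0..T} \<times> UNIV) (\<lambda>n w. \<Sum>i<n. (duhamel q ^^ i) f (fst w) (snd w))
     (\<lambda>w. wave_sol q f (fst w) (snd w)) sequentially"
  unfolding wave_sol_def
  using abs_duhamel_funpow_le_uniform[OF f b]
  by (intro Weierstrass_m_test[OF _ sums_summable[OF sums_exp_bound[of A]]]) auto

lemma strip_cont_wave_sol:
  assumes f: "strip_cont T f" and b: "\<And>t x. 0 \<le> t \<Longrightarrow> t \<le> T \<Longrightarrow> \<bar>f t x\<bar> \<le> A"
  shows "strip_cont T (wave_sol q f)"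
proof (rule strip_contI, rule uniform_limit_theorem[OF _ uniform_limit_wave_sol[OF f b]])
  show "\<forall>\<^sub>F n in sequentially. continuous_on ({0..T} \<times> UNIV)
      (\<lambda>w. \<Sum>i<n. (duhamel q ^^ i) f (fst w) (snd w))"
    using strip_cont_duhamel_funpow[OF q f]
    by (intro always_eventually allI continuous_on_sum) (simp add: strip_cont_def case_prod_beta)
qed auto

lemma wave_sol_add_cmult:
  assumes f: "strip_cont T f" and b: "\<And>t x. 0 \<le> t \<Longrightarrow> t \<le> T \<Longrightarrow> \<bar>f t x\<bar> \<le> A"
    and g: "strip_cont T g" and b': "\<And>t x. 0 \<le> t \<Longrightarrow> t \<le> T \<Longrightarrow> \<bar>g t x\<bar> \<le> A'"
    and t: "0 \<le> t" "t \<le> T"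
  shows "wave_sol q (\<lambda>t x. c * f t x + d * g t x) t x = c * wave_sol q f t x + d * wave_sol q g t x"
proof -
  have "(\<lambda>n. c * (duhamel q ^^ n) f t x + d * (duhamel q ^^ n) g t x)
      sums (c * wave_sol q f t x + d * wave_sol q g t x)"
    unfolding wave_sol_def
    by (intro sums_add sums_mult summable_sums summable_wave_sol[OF f b t] summable_wave_sol[OF g b' t])
  then show ?thesis
    by (simp add: wave_sol_def duhamel_funpow_add_cmult[OF q f g t] sums_iff)
qed

text \<open>Term-by-term differentiation: the derivative of each iterate of \<open>f\<close> is the
  same iterate of \<open>f'\<close>, and the series of these converges uniformly in \<open>x\<close>
  by the M-test.\<close>

lemma has_real_derivative_wave_sol:
  assumes f: "strip_cont T f" and b: "\<And>t x. 0 \<le> t \<Longrightarrow> t \<le> T \<Longrightarrow> \<bar>f t x\<bar> \<le> A"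
    and f': "strip_cont T f'" and b': "\<And>t x. 0 \<le> t \<Longrightarrow> t \<le> T \<Longrightarrow> \<bar>f' t x\<bar> \<le> A'"
    and der: "\<And>t x. 0 \<le> t \<Longrightarrow> t \<le> T \<Longrightarrow> (f t has_real_derivative f' t x) (at x)"
    and t: "0 \<le> t" "t \<le> T"
  shows "(wave_sol q f t has_real_derivative wave_sol q f' t x) (at x)"
proof -
  have "((\<lambda>x. \<Sum>n. (duhamel q ^^ n) f t x) has_real_derivative (\<Sum>n. (duhamel q ^^ n) f' t x)) (at x)"
  proof (rule has_field_derivative_series'(2)[where S = UNIV and ?x0.0 = 0])
    show "uniformly_convergent_on UNIV (\<lambda>n x. \<Sum>i<n. (duhamel q ^^ i) f' t x)"
      using abs_duhamel_funpow_le_uniform[OF f' b' t]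
      by (intro Weierstrass_m_test'[OF _ sums_summable[OF sums_exp_bound[of A']]]) auto
    show "summable (\<lambda>n. (duhamel q ^^ n) f t 0)" by (rule summable_wave_sol[OF f b t])
    show "((duhamel q ^^ n) f t has_real_derivative (duhamel q ^^ n) f' t x) (at x within UNIV)" for n x
      using has_real_derivative_duhamel_funpow[OF q f f' der t] by simp
  qed auto
  moreover have "wave_sol q f t = (\<lambda>x. \<Sum>n. (duhamel q ^^ n) f t x)"
    by (rule ext) (simp add: wave_sol_def)
  ultimately show ?thesis by (simp add: wave_sol_def)
qed

text \<open>\<open>duhamel\<close> sends each partial sum to the partial sum shifted by one index.
  Being bounded in the sup norm on the strip, it also commutes with the uniform limit of the partial
  sums.\<close>

lemma wave_sol_fixpoint:
  assumes f: "strip_cont T f" and b: "\<And>t x. 0 \<le> t \<Longrightarrow> t \<le> T \<Longrightarrow> \<bar>f t x\<bar> \<le> A"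
    and t: "0 \<le> t" "t \<le> T"
  shows "wave_sol q f t x = f t x + duhamel q (wave_sol q f) t x"
proof -
  let ?P = "\<lambda>n t x. \<Sum>i<n. (duhamel q ^^ i) f t x"
  have W: "strip_cont T (wave_sol q f)" using f b by (rule strip_cont_wave_sol)
  have P: "strip_cont T (?P n)" for n
    using strip_cont_duhamel_funpow[OF q f]
    by (intro strip_contI continuous_on_sum) (simp add: strip_cont_def case_prod_beta)
  have DP: "duhamel q (?P n) t x = (\<Sum>i<n. (duhamel q ^^ Suc i) f t x)" for n
  proof (induction n)
    case 0
    then show ?case by (simp add: duhamel_def mean_def)
  next
    case (Suc n)
    have "duhamel q (\<lambda>t x. 1 * ?P n t x + 1 * (duhamel q ^^ n) f t x) t x
      = 1 * duhamel q (?P n) t x + 1 * duhamel q ((duhamel q ^^ n) f) t x"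
      by (rule duhamel_add_cmult[OF q P strip_cont_duhamel_funpow[OF q f] t])
    then show ?case using Suc by simp
  qed
  have "(\<lambda>n. duhamel q (?P n) t x) \<longlonglongrightarrow> duhamel q (wave_sol q f) t x"
  proof (rule LIMSEQ_I)
    fix e :: real assume e: "0 < e"
    have B0: "0 \<le> B" using B[OF t] by linarith
    have T0: "0 \<le> T" using t by linarith
    \<comment> \<open>This choice gives \<open>d * (B * T) * T < e\<close>; the summand 1 keeps the
      denominator positive when \<open>B\<close> or \<open>T\<close> is 0.\<close>
    define d where "d = e / (B * T * T + 1)"
    have pos: "0 < B * T * T + 1" using B0 T0 by (simp add: add_nonneg_pos)
    have d: "0 < d" using e pos by (simp add: d_def)
    from uniform_limitD[OF uniform_limit_wave_sol[OF f b] d]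
    obtain N where N: "\<And>n t x. n \<ge> N \<Longrightarrow> 0 \<le> t \<Longrightarrow> t \<le> T \<Longrightarrow> \<bar>?P n t x - wave_sol q f t x\<bar> < d"
      by (fastforce simp: eventually_sequentially dist_real_def)
    have "\<bar>duhamel q (?P n) t x - duhamel q (wave_sol q f) t x\<bar> < e" if n: "n \<ge> N" for n
    proof -
      \<comment> \<open>The case \<open>n = 0\<close> of the triangle estimate, applied to the
        difference, which is written with coefficients 1 and -1 to match the linearity
        lemma.\<close>
      have "\<bar>duhamel q (\<lambda>t x. 1 * ?P n t x + (-1) * wave_sol q f t x) t x\<bar> \<le> d * (B * T) * t ^ Suc 0 / Suc 0"
      proof (rule abs_duhamel_le[OF q _ t B])
        show "strip_cont T (\<lambda>t x. 1 * ?P n t x + (-1) * wave_sol q f t x)"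
          using P[of n] W unfolding strip_cont_def case_prod_beta
          by (intro continuous_on_add continuous_on_mult continuous_on_const)
      qed (use N[OF n] in \<open>auto intro: less_imp_le\<close>)
      also have "\<dots> \<le> d * (B * T) * T"
        using d B0 T0 t by (simp add: mult_left_mono)
      also have "\<dots> < e"
        using e pos by (simp add: d_def field_simps)
      finally show ?thesis
        using duhamel_add_cmult[OF q P[of n] W t, of 1 "-1" x] by simp
    qed
    then show "\<exists>N. \<forall>n\<ge>N. norm (duhamel q (?P n) t x - duhamel q (wave_sol q f) t x) < e"
      by auto
  qed
  then have "(\<lambda>i. (duhamel q ^^ Suc i) f t x) sums duhamel q (wave_sol q f) t x"
    unfolding DP sums_def .
  \<comment> \<open>\<open>sums_Suc\<close> puts back the term of index 0, which is
    \<open>f t x\<close>.\<close>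
  from sums_Suc[OF this] show ?thesis
    by (simp add: wave_sol_def sums_iff)
qed

end

section \<open>Time derivatives of the Picard solution\<close>

lemma integral_rescale_unit:
  fixes h :: "real \<Rightarrow> real"
  assumes a: "0 \<le> a" and h: "continuous_on {0..a} h"
  shows "integral {0..1} (\<lambda>\<theta>. a * h (a * \<theta>)) = integral {0..a} h"
proof (cases "a = 0")
  case False
  have "(h has_integral integral {0..a} h) {0..a}"
    using h by (intro integrable_integral integrable_continuous_real)
  from has_integral_stretch_real[OF this False]
  have "((\<lambda>x. h (a * x)) has_integral (1 / a) * integral {0..a} h) {0..1}"
    using a False by simp
  from integral_unique[OF has_integral_mult_right[OF this, of a]] show ?thesis
    using False by simp
qed simp

lemma continuous_on_integral_upto:
  assumes g: "strip_cont T g"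
  shows "continuous_on ({0..T} \<times> UNIV) (\<lambda>w. integral {0..fst w} (\<lambda>\<tau>. g \<tau> (snd w)))"
proof -
  have "continuous_on (({0..T} \<times> UNIV) \<times> cbox 0 1)
      (\<lambda>w. fst (fst w) * g (fst (fst w) * snd w) (snd (fst w)))"
    by (intro continuous_intros strip_cont_compose[OF g]) (auto intro: scaled_time_bounds)
  then have "continuous_on ({0..T} \<times> UNIV)
      (\<lambda>w. integral (cbox 0 1) (\<lambda>\<theta>. fst w * g (fst w * \<theta>) (snd w)))"
    by (intro integral_continuous_on_param) (simp add: case_prod_beta)
  moreover have "integral {0..1} (\<lambda>\<theta>. fst w * g (fst w * \<theta>) (snd w))
      = integral {0..fst w} (\<lambda>\<tau>. g \<tau> (snd w))" if "w \<in> {0..T} \<times> UNIV" for w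
    using that
    by (intro integral_rescale_unit strip_cont_compose[OF g] continuous_intros) auto
  ultimately show ?thesis by (simp cong: continuous_on_cong)
qed

text \<open>Here \<open>s\<close> is both the upper limit and a parameter. With these separated into
  \<open>(a, b)\<close>, the integral is totally differentiable because its
  \<open>b\<close>-derivative is jointly continuous; restriction to the diagonal adds up the two
  partial derivatives.\<close>

lemma has_real_derivative_integral_upto:
  assumes g: "strip_cont T g" and g': "strip_cont T g'"
    and der: "\<And>\<tau> s. 0 \<le> \<tau> \<Longrightarrow> \<tau> \<le> T \<Longrightarrow> (g \<tau> has_real_derivative g' \<tau> s) (at s)"
    and t: "0 < t" "t < T"
  shows "((\<lambda>s. integral {0..s} (\<lambda>\<tau>. g \<tau> s)) has_real_derivative
     g t t + integral {0..t} (\<lambda>\<tau>. g' \<tau> t)) (at t)"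
proof -
  let ?f = "\<lambda>a b. integral {0..a} (\<lambda>\<tau>. g \<tau> b)"
  let ?fy = "\<lambda>a b. blinfun_mult_right (integral {0..a} (\<lambda>\<tau>. g' \<tau> b))"
  have "((\<lambda>(a, b). ?f a b) has_derivative (\<lambda>(ta, tb). g t t * ta + ?fy t t tb))
      (at (t, t) within {0..T} \<times> UNIV)"
  \<comment> \<open>The criterion asks for one partial derivative that is continuous as a bounded
    linear map, hence the \<open>blinfun\<close> form of \<open>fy\<close>.\<close>
  proof (rule has_derivative_partialsI[where fx = "(*) (g t t)" and fy = ?fy])
    show "((\<lambda>a. ?f a t) has_derivative (*) (g t t)) (at t within {0..T})"
      unfolding has_field_derivative_def[symmetric]
      by (rule integral_has_real_derivative)
        (use t in \<open>auto intro!: strip_cont_compose[OF g] continuous_intros\<close>)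
  next
    fix a b assume a: "a \<in> {0..T}"
    have "((\<lambda>b. integral (cbox 0 a) (\<lambda>\<tau>. g \<tau> b)) has_real_derivative
        integral (cbox 0 a) (\<lambda>\<tau>. g' \<tau> b)) (at b within UNIV)"
    proof (rule leibniz_rule_field_derivative)
      fix b show "(\<lambda>\<tau>. g \<tau> b) integrable_on cbox 0 a"
        by (intro integrable_continuous strip_cont_compose[OF g] continuous_intros) (use a in auto)
      show "continuous_on (UNIV \<times> cbox 0 a) (\<lambda>(x, \<tau>). g' \<tau> x)"
        unfolding case_prod_beta
        by (intro strip_cont_compose[OF g'] continuous_intros) (use a in auto)
    qed (use a der in auto)
    then show "((\<lambda>b. ?f a b) has_derivative blinfun_apply (?fy a b)) (at b within UNIV)"
      by (simp add: has_field_derivative_def)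
  next
    show "continuous (at (t, t) within {0..T} \<times> UNIV) (\<lambda>(a, b). ?fy a b)"
      using continuous_on_integral_upto[OF g'] t
      unfolding case_prod_beta
      by (intro bounded_linear.continuous[OF bounded_linear_blinfun_mult_right])
        (auto simp: continuous_on_eq_continuous_within)
  qed auto
  moreover have "at (t, t) within {0..T} \<times> UNIV = at (t, t)"
    using t by (intro at_within_interior) (simp add: interior_Times)
  ultimately have partials:
    "((\<lambda>(a, b). ?f a b) has_derivative (\<lambda>(ta, tb). g t t * ta + ?fy t t tb)) (at (t, t))"
    by (simp only:)
  have "((\<lambda>s. (s, s)) has_derivative (\<lambda>h. (h, h))) (at t)"
    by (auto intro!: derivative_eq_intros)
  from has_derivative_compose[OF this partials] have "((\<lambda>s. case (s, s) of (a, b) \<Rightarrow> ?f a b) has_derivative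
      (\<lambda>h. case (h, h) of (ta, tb) \<Rightarrow> g t t * ta + ?fy t t tb)) (at t)" .
  moreover have "(\<lambda>h. case (h, h) of (ta, tb) \<Rightarrow> g t t * ta + ?fy t t tb)
      = (*) (g t t + integral {0..t} (\<lambda>\<tau>. g' \<tau> t))"
    by (rule ext) (simp add: algebra_simps)
  ultimately show ?thesis
    by (simp only: has_field_derivative_def prod.case)
qed

text \<open>The substitution \<open>y = x + a * z\<close> turns the scaled average into half the
  integral of \<open>f t\<close> from \<open>x - a\<close> to \<open>x + a\<close>. In this form
  \<open>a\<close> may also be zero or negative.\<close>

lemma scaled_mean_eq:
  assumes "\<And>y. \<bar>y - x\<bar> \<le> \<bar>a\<bar> \<Longrightarrow> (F has_real_derivative f t y) (at y)"
  shows "a * mean f t a x = (F (x + a) - F (x - a)) / 2"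
proof -
  have "((\<lambda>z. a * f t (x + a * z)) has_integral (F (x + a * 1) - F (x + a * (-1)))) {-1..1}"
  proof (rule fundamental_theorem_of_calculus)
    fix z :: real assume z: "z \<in> {-1..1}"
    have "\<bar>a\<bar> * \<bar>z\<bar> \<le> \<bar>a\<bar> * 1" using z by (intro mult_left_mono) auto
    then have "(F has_real_derivative f t (x + a * z)) (at (x + a * z))"
      by (intro assms) (simp add: abs_mult)
    then have "((\<lambda>z. F (x + a * z)) has_real_derivative f t (x + a * z) * a) (at z)"
      by (rule DERIV_chain2[where f = F and g = "\<lambda>z. x + a * z"])
        (auto intro!: derivative_eq_intros)
    then show "((\<lambda>z. F (x + a * z)) has_vector_derivative a * f t (x + a * z)) (at z within {-1..1})"
      by (simp add: mult.commute has_real_derivative_iff_has_vector_derivative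
          has_vector_derivative_at_within)
  qed simp
  from integral_unique[OF this]
  have "integral {-1..1} (\<lambda>z. a * f t (x + a * z)) = F (x + a) - F (x - a)"
    by simp
  then show ?thesis by (simp add: mean_def)
qed

lemma has_real_derivative_scaled_mean:
  assumes f: "strip_cont T f" and t: "0 \<le> t" "t \<le> T"
  shows "((\<lambda>a. a * mean f t a x) has_real_derivative (f t (x + a) + f t (x - a)) / 2) (at a)"
proof -
  \<comment> \<open>One unit of room beyond \<open>|a|\<close>. With the base point
    \<open>x - L - 1\<close>, every \<open>y\<close> within \<open>L\<close> of \<open>x\<close> is
    interior to the interval of integration, so \<open>F\<close> has a two-sided derivative
    there.\<close>
  define L where "L = \<bar>a\<bar> + 1"
  define F where "F = (\<lambda>y. integral {x - L - 1..y} (f t))"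
  have F: "(F has_real_derivative f t y) (at y)" if "\<bar>y - x\<bar> \<le> L" for y
  proof -
    have "(F has_real_derivative f t y) (at y within {x - L - 1..x + L + 1})"
      unfolding F_def using that
      by (intro integral_has_real_derivative continuous_on_strip_slice[OF f t] continuous_intros) auto
    moreover have "at y within {x - L - 1..x + L + 1} = at y"
      using that by (intro at_within_interior) auto
    ultimately show ?thesis by (simp only:)
  qed
  have "((\<lambda>a. F (x + a)) has_real_derivative f t (x + a) * 1) (at a)"
    by (rule DERIV_chain2[where f = F and g = "\<lambda>a. x + a"], rule F)
      (auto intro!: derivative_eq_intros simp: L_def)
  moreover have "((\<lambda>a. F (x - a)) has_real_derivative f t (x - a) * (-1)) (at a)"
    by (rule DERIV_chain2[where f = F and g = "\<lambda>a. x - a"], rule F)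
      (auto intro!: derivative_eq_intros simp: L_def)
  ultimately have "((\<lambda>a. (F (x + a) - F (x - a)) / 2) has_real_derivative
      (f t (x + a) * 1 - f t (x - a) * (-1)) / 2) (at a)"
    by (intro DERIV_cdivide DERIV_diff)
  then have "((\<lambda>a. a * mean f t a x) has_real_derivative (f t (x + a) * 1 - f t (x - a) * (-1)) / 2) (at a)"
  proof (rule has_field_derivative_transform_within_open[where S = "{-L<..<L}"])
    fix b assume "b \<in> {-L<..<L}"
    then show "(F (x + b) - F (x - b)) / 2 = b * mean f t b x"
      by (intro scaled_mean_eq[symmetric] F) auto
  qed (auto simp: L_def)
  then show ?thesis by simp
qed

text \<open>The time derivative of \<open>duhamel\<close>: integration along the two slanted sides
  of the backward triangle replaces integration over its interior.\<close>

definition duhamel_dt ::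
  "(real \<Rightarrow> real) \<Rightarrow> (real \<Rightarrow> real \<Rightarrow> real) \<Rightarrow> real \<Rightarrow> real \<Rightarrow> real" where
  "duhamel_dt q f t x = integral {0..t} (\<lambda>\<tau>. q \<tau> * ((f \<tau> (x + (t - \<tau>)) + f \<tau> (x - (t - \<tau>))) / 2))"

lemma strip_cont_duhamel_dt_kernel:
  assumes q: "continuous_on {0..T} q" and f: "strip_cont T f"
  shows "strip_cont T (\<lambda>\<tau> s. q \<tau> * ((f \<tau> (x + (s - \<tau>)) + f \<tau> (x - (s - \<tau>))) / 2))"
  by (intro strip_contI continuous_intros strip_cont_compose[OF f] continuous_on_compose2[OF q, where f = fst])
    auto

lemma strip_cont_duhamel_kernel:
  assumes q: "continuous_on {0..T} q" and f: "strip_cont T f"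
  shows "strip_cont T (\<lambda>\<tau> s. q \<tau> * ((s - \<tau>) * mean f \<tau> (s - \<tau>) x))"
  by (intro strip_contI continuous_intros continuous_on_mean[OF f] continuous_on_compose2[OF q, where f = fst])
    auto

lemma continuous_on_duhamel_dt:
  assumes q: "continuous_on {0..T} q" and f: "strip_cont T f"
  shows "continuous_on {0..T} (\<lambda>t. duhamel_dt q f t x)"
proof -
  have "continuous_on {0..T} (\<lambda>t. (t, t))" "(\<lambda>t. (t, t)) ` {0..T} \<subseteq> {0..T} \<times> UNIV"
    by (auto intro!: continuous_intros)
  from continuous_on_compose2[OF continuous_on_integral_upto[OF strip_cont_duhamel_dt_kernel[OF q f]] this]
  show ?thesis by (simp add: duhamel_dt_def)
qed

lemma duhamel_eq_integral_upto:
  assumes q: "continuous_on {0..T} q" and f: "strip_cont T f" and t: "0 \<le> t" "t \<le> T"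
  shows "duhamel q f t x = integral {0..t} (\<lambda>\<tau>. q \<tau> * ((t - \<tau>) * mean f \<tau> (t - \<tau>) x))"
proof -
  have "continuous_on {0..t} (\<lambda>\<tau>. q \<tau> * ((t - \<tau>) * mean f \<tau> (t - \<tau>) x))"
    by (intro strip_cont_compose[OF strip_cont_duhamel_kernel[OF q f]] continuous_intros)
      (use t in auto)
  from integral_rescale_unit[OF t(1) this] show ?thesis
    by (simp add: duhamel_def right_diff_distrib)
qed

text \<open>The boundary term of the Leibniz rule carries the factor \<open>t - t\<close> and drops
  out; only the derivative of the kernel remains.\<close>

lemma has_real_derivative_duhamel_time:
  assumes q: "continuous_on {0..T} q" and f: "strip_cont T f" and t: "0 < t" "t < T"
  shows "((\<lambda>t. duhamel q f t x) has_real_derivative duhamel_dt q f t x) (at t)"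
proof -
  have "((\<lambda>s. integral {0..s} (\<lambda>\<tau>. q \<tau> * ((s - \<tau>) * mean f \<tau> (s - \<tau>) x))) has_real_derivative
     q t * ((t - t) * mean f t (t - t) x) +
     integral {0..t} (\<lambda>\<tau>. q \<tau> * ((f \<tau> (x + (t - \<tau>)) + f \<tau> (x - (t - \<tau>))) / 2))) (at t)"
  proof (rule has_real_derivative_integral_upto[OF strip_cont_duhamel_kernel[OF q f]
        strip_cont_duhamel_dt_kernel[OF q f] _ t])
    fix \<tau> s assume \<tau>: "0 \<le> \<tau>" "\<tau> \<le> T"
    show "((\<lambda>s. q \<tau> * ((s - \<tau>) * mean f \<tau> (s - \<tau>) x)) has_real_derivative
        q \<tau> * ((f \<tau> (x + (s - \<tau>)) + f \<tau> (x - (s - \<tau>))) / 2)) (at s)"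
      using DERIV_shift[of "\<lambda>a. a * mean f \<tau> a x" _ s "-\<tau>"]
        has_real_derivative_scaled_mean[OF f \<tau>, of x "s - \<tau>"]
      by (intro DERIV_cmult) simp
  qed
  then have "((\<lambda>s. integral {0..s} (\<lambda>\<tau>. q \<tau> * ((s - \<tau>) * mean f \<tau> (s - \<tau>) x))) has_real_derivative
     duhamel_dt q f t x) (at t)"
    by (simp add: duhamel_dt_def)
  then show ?thesis
    by (rule has_field_derivative_transform_within_open[where S = "{0<..<T}"])
      (use t in \<open>auto simp: duhamel_eq_integral_upto[OF q f]\<close>)
qed

text \<open>Now the boundary term survives as \<open>q t * f t x\<close>. The average over the two
  sides has as derivative half a difference of values of \<open>f'\<close>, which is the scaled
  average of \<open>f''\<close>, and this reproduces \<open>duhamel\<close>.\<close>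

lemma has_real_derivative_duhamel_dt:
  assumes q: "continuous_on {0..T} q"
    and f: "strip_cont T f" and f': "strip_cont T f'" and f'': "strip_cont T f''"
    and der: "\<And>t x. 0 \<le> t \<Longrightarrow> t \<le> T \<Longrightarrow> (f t has_real_derivative f' t x) (at x)"
    and der': "\<And>t x. 0 \<le> t \<Longrightarrow> t \<le> T \<Longrightarrow> (f' t has_real_derivative f'' t x) (at x)"
    and t: "0 < t" "t < T"
  shows "((\<lambda>t. duhamel_dt q f t x) has_real_derivative q t * f t x + duhamel q f'' t x) (at t)"
proof -
  have "((\<lambda>s. integral {0..s} (\<lambda>\<tau>. q \<tau> * ((f \<tau> (x + (s - \<tau>)) + f \<tau> (x - (s - \<tau>))) / 2)))
     has_real_derivative q t * ((f t (x + (t - t)) + f t (x - (t - t))) / 2) +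
     integral {0..t} (\<lambda>\<tau>. q \<tau> * ((t - \<tau>) * mean f'' \<tau> (t - \<tau>) x))) (at t)"
  proof (rule has_real_derivative_integral_upto[OF strip_cont_duhamel_dt_kernel[OF q f]
        strip_cont_duhamel_kernel[OF q f''] _ t])
    fix \<tau> s assume \<tau>: "0 \<le> \<tau>" "\<tau> \<le> T"
    have eq: "(s - \<tau>) * mean f'' \<tau> (s - \<tau>) x = (f' \<tau> (x + (s - \<tau>)) - f' \<tau> (x - (s - \<tau>))) / 2"
      by (rule scaled_mean_eq) (rule der'[OF \<tau>])
    have "((\<lambda>s. f \<tau> (x + (s - \<tau>))) has_real_derivative f' \<tau> (x + (s - \<tau>)) * 1) (at s)"
      by (rule DERIV_chain2[OF der[OF \<tau>], where g = "\<lambda>s. x + (s - \<tau>)"]) (auto intro!: derivative_eq_intros)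
    moreover have "((\<lambda>s. f \<tau> (x - (s - \<tau>))) has_real_derivative f' \<tau> (x - (s - \<tau>)) * (-1)) (at s)"
      by (rule DERIV_chain2[OF der[OF \<tau>], where g = "\<lambda>s. x - (s - \<tau>)"]) (auto intro!: derivative_eq_intros)
    ultimately have "((\<lambda>s. (f \<tau> (x + (s - \<tau>)) + f \<tau> (x - (s - \<tau>))) / 2) has_real_derivative
       (f' \<tau> (x + (s - \<tau>)) * 1 + f' \<tau> (x - (s - \<tau>)) * (-1)) / 2) (at s)"
      by (intro DERIV_cdivide DERIV_add)
    then show "((\<lambda>s. q \<tau> * ((f \<tau> (x + (s - \<tau>)) + f \<tau> (x - (s - \<tau>))) / 2)) has_real_derivative
        q \<tau> * ((s - \<tau>) * mean f'' \<tau> (s - \<tau>) x)) (at s)"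
      unfolding eq by (intro DERIV_cmult) simp
  qed
  then show ?thesis
    using t by (simp add: duhamel_dt_def duhamel_eq_integral_upto[OF q f''])
qed

section \<open>The Picard solution satisfies the wave equation with potential\<close>

context
  fixes T B :: real and q :: "real \<Rightarrow> real"
  assumes q: "continuous_on {0..T} q" and B: "\<And>t. 0 \<le> t \<Longrightarrow> t \<le> T \<Longrightarrow> \<bar>q t\<bar> \<le> B"
begin

text \<open>In time it is not the series that is differentiated but the fixed-point equation, whose
  Duhamel term is differentiable as soon as the solution is continuous.\<close>

lemma has_real_derivative_wave_sol_time:
  assumes f: "strip_cont T f" and b: "\<And>t x. 0 \<le> t \<Longrightarrow> t \<le> T \<Longrightarrow> \<bar>f t x\<bar> \<le> A"
    and ft: "((\<lambda>t. f t x) has_real_derivative ft) (at t)" and t: "0 < t" "t < T"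
  shows "((\<lambda>t. wave_sol q f t x) has_real_derivative ft + duhamel_dt q (wave_sol q f) t x) (at t)"
proof -
  have W: "strip_cont T (wave_sol q f)" using q B f b by (rule strip_cont_wave_sol)
  have "((\<lambda>t. f t x + duhamel q (wave_sol q f) t x) has_real_derivative
      ft + duhamel_dt q (wave_sol q f) t x) (at t)"
    by (intro DERIV_add ft has_real_derivative_duhamel_time[OF q W t])
  then show ?thesis
  proof (rule has_field_derivative_transform_within_open[where S = "{0<..<T}"])
    fix s assume "s \<in> {0<..<T}"
    then have s: "0 \<le> s" "s \<le> T" by auto
    show "f s x + duhamel q (wave_sol q f) s x = wave_sol q f s x"
      using wave_sol_fixpoint[OF q B f b s, of x] by simp
  qed (use t in auto)
qed

text \<open>The function \<open>ft\<close> plays the role of the time derivative of \<open>f\<close>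
  at the fixed \<open>x\<close>, so \<open>ftt\<close> is the free wave equation there. By the
  fixed-point equation for \<open>f''\<close>, the terms \<open>f'' t x\<close> and
  \<open>duhamel q (wave_sol q f'') t x\<close> recombine to the second space derivative of the
  solution.\<close>

lemma has_real_derivative_wave_sol_time_dt:
  assumes f: "strip_cont T f" and b: "\<And>t x. 0 \<le> t \<Longrightarrow> t \<le> T \<Longrightarrow> \<bar>f t x\<bar> \<le> A"
    and f': "strip_cont T f'" and b': "\<And>t x. 0 \<le> t \<Longrightarrow> t \<le> T \<Longrightarrow> \<bar>f' t x\<bar> \<le> A'"
    and f'': "strip_cont T f''" and b'': "\<And>t x. 0 \<le> t \<Longrightarrow> t \<le> T \<Longrightarrow> \<bar>f'' t x\<bar> \<le> A''"
    and der: "\<And>t x. 0 \<le> t \<Longrightarrow> t \<le> T \<Longrightarrow> (f t has_real_derivative f' t x) (at x)"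
    and der': "\<And>t x. 0 \<le> t \<Longrightarrow> t \<le> T \<Longrightarrow> (f' t has_real_derivative f'' t x) (at x)"
    and ftt: "(ft has_real_derivative f'' t x) (at t)" and t: "0 < t" "t < T"
  shows "((\<lambda>t. ft t + duhamel_dt q (wave_sol q f) t x) has_real_derivative
     q t * wave_sol q f t x + wave_sol q f'' t x) (at t)"
proof -
  have W: "strip_cont T (wave_sol q f)" using q B f b by (rule strip_cont_wave_sol)
  have W': "strip_cont T (wave_sol q f')" using q B f' b' by (rule strip_cont_wave_sol)
  have W'': "strip_cont T (wave_sol q f'')" using q B f'' b'' by (rule strip_cont_wave_sol)
  have "((\<lambda>t. ft t + duhamel_dt q (wave_sol q f) t x) has_real_derivative
     f'' t x + (q t * wave_sol q f t x + duhamel q (wave_sol q f'') t x)) (at t)"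
    by (intro DERIV_add ftt has_real_derivative_duhamel_dt[OF q W W' W'' _ _ t])
      (auto intro: has_real_derivative_wave_sol[OF q B f b f' b' der]
        has_real_derivative_wave_sol[OF q B f' b' f'' b'' der'])
  moreover have "wave_sol q f'' t x = f'' t x + duhamel q (wave_sol q f'') t x"
    using wave_sol_fixpoint[OF q B f'' b''] t by simp
  ultimately show ?thesis by (simp add: algebra_simps)
qed

end

section \<open>The gas-dynamic coefficients as functions of the characteristic time\<close>

text \<open>Positivity is asked only in the interior because the integrand of
  \<open>nu_of_rho\<close> vanishes at 0 and that of the characteristic time vanishes at
  \<open>rho_cr\<close>.\<close>

lemma integral_upto_increasing:
  fixes f :: "real \<Rightarrow> real"
  assumes f: "continuous_on {0..c} f" and pos: "\<And>x. 0 < x \<Longrightarrow> x < c \<Longrightarrow> 0 < f x"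
  shows "continuous_on {0..c} (\<lambda>r. integral {0..r} f)"
    and "\<And>x. 0 < x \<Longrightarrow> x < c \<Longrightarrow> ((\<lambda>r. integral {0..r} f) has_real_derivative f x) (at x)"
    and "strict_mono_on {0..c} (\<lambda>r. integral {0..r} f)"
proof -
  show cont: "continuous_on {0..c} (\<lambda>r. integral {0..r} f)"
    using f by (intro indefinite_integral_continuous_1 integrable_continuous_real)
  show der: "((\<lambda>r. integral {0..r} f) has_real_derivative f x) (at x)" if x: "0 < x" "x < c" for x
  proof -
    have "((\<lambda>r. integral {0..r} f) has_real_derivative f x) (at x within {0..c})"
      by (rule integral_has_real_derivative[OF f]) (use x in auto)
    moreover have "at x within {0..c} = at x"
      using x by (intro at_within_interior) auto
    ultimately show ?thesis by (simp only:)
  qed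
  show "strict_mono_on {0..c} (\<lambda>r. integral {0..r} f)"
  proof (rule strict_mono_onI)
    fix x y assume xy: "x \<in> {0..c}" "y \<in> {0..c}" "x < y"
    show "integral {0..x} f < integral {0..y} f"
    proof (rule DERIV_pos_imp_increasing_open[OF xy(3)])
      fix z assume "x < z" "z < y"
      then have "0 < z" "z < c" using xy by auto
      then show "\<exists>d. ((\<lambda>r. integral {0..r} f) has_real_derivative d) (at z) \<and> d > 0"
        using der pos by blast
    next
      show "continuous_on {x..y} (\<lambda>r. integral {0..r} f)"
        by (rule continuous_on_subset[OF cont]) (use xy in auto)
    qed
  qed
qed

text \<open>Compactness of \<open>{0..c}\<close> makes the inverse continuous up to both ends.
  Differentiability is claimed only inside, since the derivative of \<open>F\<close> may degenerate
  at an end.\<close>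

lemma increasing_inverse:
  fixes F R :: "real \<Rightarrow> real"
  assumes c: "0 < c" and cont: "continuous_on {0..c} F" and mono: "strict_mono_on {0..c} F"
    and F0: "F 0 = 0" and inv: "\<forall>r\<in>{0..c}. R (F r) = r"
  shows "continuous_on {0..F c} R"
    and "\<And>y. 0 < y \<Longrightarrow> y < F c \<Longrightarrow> 0 < R y \<and> R y < c \<and> F (R y) = y"
    and "\<And>y d. 0 < y \<Longrightarrow> y < F c \<Longrightarrow> (F has_real_derivative d) (at (R y)) \<Longrightarrow> d \<noteq> 0 \<Longrightarrow>
      (R has_real_derivative inverse d) (at y)"
proof -
  have surj: "\<exists>r. 0 \<le> r \<and> r \<le> c \<and> F r = y" if "0 \<le> y" "y \<le> F c" for y
    using IVT'[of F 0 y c] that c cont F0 by auto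
  have "F ` {0..c} = {0..F c}"
  proof safe
    fix r assume r: "r \<in> {0..c}"
    have "F 0 \<le> F r" "F r \<le> F c"
      using r c strict_mono_on_leD[OF mono] by auto
    then show "F r \<in> {0..F c}" using F0 by simp
  next
    fix y assume "y \<in> {0..F c}"
    then show "y \<in> F ` {0..c}" using surj[of y] by auto
  qed
  then show contR: "continuous_on {0..F c} R"
    using continuous_on_inv[OF cont _ inv] by simp
  show R: "0 < R y \<and> R y < c \<and> F (R y) = y" if y: "0 < y" "y < F c" for y
  proof -
    obtain r where r: "0 \<le> r" "r \<le> c" "F r = y" using surj[of y] y by auto
    with y F0 have "r \<noteq> 0" "r \<noteq> c" by auto
    moreover have "R y = r" using r inv by auto
    ultimately show ?thesis using r by auto
  qed
  fix y d assume y: "0 < y" "y < F c" and d: "(F has_real_derivative d) (at (R y))" "d \<noteq> 0"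
  show "(R has_real_derivative inverse d) (at y)"
  proof (rule DERIV_inverse_function[where f = F and g = R, OF d y])
    show "isCont R y"
      by (rule continuous_on_interior[OF contR]) (use y in auto)
  qed (use R in auto)
qed

section \<open>The density on the supersonic range up to \<open>nu_cr\<close>\<close>

abbreviation rho_cr :: real where "rho_cr \<equiv> 1 / sqrt 2"

lemma rho_cr_bounds: "0 < rho_cr" "rho_cr < 1"
  by (auto simp: real_less_rsqrt)

lemma below_rho_cr:
  assumes "0 \<le> r"
  shows "r < rho_cr \<Longrightarrow> 0 < 1 - 2 * r\<^sup>2" "r \<le> rho_cr \<Longrightarrow> 0 < 1 - r\<^sup>2"
proof -
  have sq: "rho_cr\<^sup>2 = 1 / 2" by (simp add: power_divide)
  show "0 < 1 - 2 * r\<^sup>2" if "r < rho_cr"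
    using power_strict_mono[OF that assms, of 2] sq by simp
  show "0 < 1 - r\<^sup>2" if "r \<le> rho_cr"
    using power_mono[OF that assms, of 2] sq by simp
qed

text \<open>The bound \<open>c\<close> is left free below 1 because uniqueness in the definition of
  \<open>rho\<close> compares densities in all of \<open>[0, 1)\<close>, also beyond the sonic
  one.\<close>

lemma nu_of_rho_increasing:
  assumes "c < 1"
  shows "continuous_on {0..c} nu_of_rho"
    and "\<And>x. 0 < x \<Longrightarrow> x < c \<Longrightarrow> (nu_of_rho has_real_derivative x\<^sup>2 / (1 - x\<^sup>2)) (at x)"
    and "strict_mono_on {0..c} nu_of_rho"
proof -
  have pos: "0 < 1 - x\<^sup>2" if "0 \<le> x" "x \<le> c" for x :: real
    using that assms by (simp add: power_less_one_iff)
  have eq: "nu_of_rho = (\<lambda>r. integral {0..r} (\<lambda>\<tau>. \<tau>^2 / (1 - \<tau>^2)))"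
    by (rule ext) (rule nu_of_rho_def)
  have f: "continuous_on {0..c} (\<lambda>\<tau>. \<tau>^2 / (1 - \<tau>^2))"
    using pos by (intro continuous_intros) fastforce
  have f0: "0 < x\<^sup>2 / (1 - x\<^sup>2)" if "0 < x" "x < c" for x :: real
    using pos[of x] that by simp
  show "continuous_on {0..c} nu_of_rho"
    and "\<And>x. 0 < x \<Longrightarrow> x < c \<Longrightarrow> (nu_of_rho has_real_derivative x\<^sup>2 / (1 - x\<^sup>2)) (at x)"
    and "strict_mono_on {0..c} nu_of_rho"
    unfolding eq using integral_upto_increasing[OF f f0] by blast+
qed

lemma rho_nu_of_rho:
  assumes "0 \<le> r" "r < 1"
  shows "rho (nu_of_rho r) = r"
  unfolding rho_def
proof (rule the_equality)
  fix s assume s: "0 \<le> s \<and> s < 1 \<and> nu_of_rho s = nu_of_rho r"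
  have "strict_mono_on {0..max r s} nu_of_rho"
    using assms s by (intro nu_of_rho_increasing) auto
  then have "inj_on nu_of_rho {0..max r s}" by (rule strict_mono_on_imp_inj_on)
  then show "s = r" using s assms by (auto dest!: inj_onD)
qed (use assms in auto)

lemma nu_of_rho_0: "nu_of_rho 0 = 0"
  by (simp add: nu_of_rho_def)

lemma rho_nu_of_rho_le_sonic: "\<forall>r\<in>{0..rho_cr}. rho (nu_of_rho r) = r"
proof
  fix r assume "r \<in> {0..rho_cr}"
  then show "rho (nu_of_rho r) = r"
    using rho_cr_bounds(2) by (intro rho_nu_of_rho) (simp, simp only: atLeastAtMost_iff, linarith)
qed

lemmas rho_inverse = increasing_inverse[where F = nu_of_rho and R = rho, OF rho_cr_bounds(1)
    nu_of_rho_increasing(1)[OF rho_cr_bounds(2)] nu_of_rho_increasing(3)[OF rho_cr_bounds(2)]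
    nu_of_rho_0 rho_nu_of_rho_le_sonic, folded nu_cr_def]

lemma continuous_on_rho: "continuous_on {0..nu_cr} rho"
  by (rule rho_inverse(1))

lemma rho_bounds:
  assumes "0 < v" "v < nu_cr"
  shows "0 < rho v" "rho v < rho_cr" "nu_of_rho (rho v) = v"
  using rho_inverse(2)[OF assms] by auto

lemma has_real_derivative_rho:
  assumes v: "0 < v" "v < nu_cr"
  shows "(rho has_real_derivative (1 - (rho v)\<^sup>2) / (rho v)\<^sup>2) (at v)"
proof -
  note r = rho_bounds[OF v]
  have pos: "0 < 1 - (rho v)\<^sup>2" using below_rho_cr(2)[of "rho v"] r by simp
  have "(rho has_real_derivative inverse ((rho v)\<^sup>2 / (1 - (rho v)\<^sup>2))) (at v)"
    using nu_of_rho_increasing(2)[OF rho_cr_bounds(2) r(1,2)] r pos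
    by (intro rho_inverse(3)[OF v]) auto
  then show ?thesis by simp
qed

lemma rho_0: "rho 0 = 0"
  using rho_nu_of_rho[of 0] by (simp add: nu_of_rho_0)

lemma nu_cr_pos: "0 < nu_cr"
  using strict_mono_onD[OF nu_of_rho_increasing(3)[OF rho_cr_bounds(2)], of 0 rho_cr]
    rho_cr_bounds by (simp add: nu_cr_def nu_of_rho_0)

text \<open>The characteristic speed as a function of the density: \<open>k'\<close> contributes
  \<open>sqrt (1 - 2 * x^2) / x^2\<close> and the derivative of \<open>nu_of_rho\<close> contributes
  \<open>x^2 / (1 - x^2)\<close>, so the singular factor cancels and the integrand is continuous at
  0.\<close>

definition time_of_rho :: "real \<Rightarrow> real" where
  "time_of_rho r = integral {0..r} (\<lambda>x. sqrt (1 - 2 * x\<^sup>2) / (1 - x\<^sup>2))"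

definition rho_of_time :: "real \<Rightarrow> real" where
  "rho_of_time = the_inv_into {0..rho_cr} time_of_rho"

definition time_cr :: real where
  "time_cr = time_of_rho rho_cr"

lemma time_of_rho_increasing:
  shows "continuous_on {0..rho_cr} time_of_rho"
    and "\<And>x. 0 < x \<Longrightarrow> x < rho_cr \<Longrightarrow>
      (time_of_rho has_real_derivative sqrt (1 - 2 * x\<^sup>2) / (1 - x\<^sup>2)) (at x)"
    and "strict_mono_on {0..rho_cr} time_of_rho"
proof -
  have eq: "time_of_rho = (\<lambda>r. integral {0..r} (\<lambda>x. sqrt (1 - 2 * x\<^sup>2) / (1 - x\<^sup>2)))"
    by (rule ext) (rule time_of_rho_def)
  have f: "continuous_on {0..rho_cr} (\<lambda>x. sqrt (1 - 2 * x\<^sup>2) / (1 - x\<^sup>2))"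
    using below_rho_cr(2) by (intro continuous_intros) fastforce
  have f0: "0 < sqrt (1 - 2 * x\<^sup>2) / (1 - x\<^sup>2)" if "0 < x" "x < rho_cr" for x :: real
    using below_rho_cr(1,2)[of x] that by simp
  show "continuous_on {0..rho_cr} time_of_rho"
    and "\<And>x. 0 < x \<Longrightarrow> x < rho_cr \<Longrightarrow>
      (time_of_rho has_real_derivative sqrt (1 - 2 * x\<^sup>2) / (1 - x\<^sup>2)) (at x)"
    and "strict_mono_on {0..rho_cr} time_of_rho"
    unfolding eq using integral_upto_increasing[OF f f0] by blast+
qed

lemma time_of_rho_0: "time_of_rho 0 = 0"
  by (simp add: time_of_rho_def)

lemma rho_of_time_of_rho: "\<forall>r\<in>{0..rho_cr}. rho_of_time (time_of_rho r) = r"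
  unfolding rho_of_time_def
  by (intro ballI the_inv_into_f_f strict_mono_on_imp_inj_on[OF time_of_rho_increasing(3)]) auto

lemmas rho_of_time_inverse = increasing_inverse[where F = time_of_rho and R = rho_of_time,
    OF rho_cr_bounds(1) time_of_rho_increasing(1) time_of_rho_increasing(3) time_of_rho_0
    rho_of_time_of_rho, folded time_cr_def]

lemma rho_of_time_0: "rho_of_time 0 = 0"
  using bspec[OF rho_of_time_of_rho, of 0] by (simp add: time_of_rho_0)

lemma rho_of_time_bounds:
  assumes "0 < t" "t < time_cr"
  shows "0 < rho_of_time t" "rho_of_time t < rho_cr"
  using rho_of_time_inverse(2)[OF assms] by auto

lemma has_real_derivative_rho_of_time:
  assumes t: "0 < t" "t < time_cr"
  shows "(rho_of_time has_real_derivative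
    (1 - (rho_of_time t)\<^sup>2) / sqrt (1 - 2 * (rho_of_time t)\<^sup>2)) (at t)"
proof -
  note r = rho_of_time_bounds[OF t]
  have pos: "0 < 1 - (rho_of_time t)\<^sup>2" "0 < 1 - 2 * (rho_of_time t)\<^sup>2"
    using below_rho_cr(1,2)[of "rho_of_time t"] r by auto
  have "(rho_of_time has_real_derivative
      inverse (sqrt (1 - 2 * (rho_of_time t)\<^sup>2) / (1 - (rho_of_time t)\<^sup>2))) (at t)"
    using time_of_rho_increasing(2)[OF r] pos
    by (intro rho_of_time_inverse(3)[OF t]) auto
  then show ?thesis by simp
qed

lemma time_of_rho_bounds:
  assumes "0 < r" "r < rho_cr"
  shows "0 < time_of_rho r" "time_of_rho r < time_cr"
  using strict_mono_onD[OF time_of_rho_increasing(3), of 0 r]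
    strict_mono_onD[OF time_of_rho_increasing(3), of r rho_cr] assms
  by (auto simp: time_cr_def time_of_rho_0)

lemma time_cr_pos: "0 < time_cr"
  using time_of_rho_bounds[of "1 / 2"] by (simp add: real_sqrt_less_iff real_less_lsqrt)

lemma has_real_derivative_time_of_rho_rho:
  assumes v: "0 < v" "v < nu_cr"
  shows "((\<lambda>v. time_of_rho (rho v)) has_real_derivative sqrt (1 - 2 * (rho v)\<^sup>2) / (rho v)\<^sup>2) (at v)"
proof -
  note r = rho_bounds[OF v]
  have pos: "0 < 1 - (rho v)\<^sup>2" using below_rho_cr(2)[of "rho v"] r by simp
  show ?thesis
    using DERIV_chain2[OF time_of_rho_increasing(2)[OF r(1,2)] has_real_derivative_rho[OF v]] pos
    by simp
qed

lemma continuous_on_time_of_rho_rho: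
  assumes "v < nu_cr"
  shows "continuous_on {0..v} (\<lambda>v. time_of_rho (rho v))"
proof (rule continuous_on_compose2[OF time_of_rho_increasing(1)])
  show "continuous_on {0..v} rho"
    by (rule continuous_on_subset[OF continuous_on_rho]) (use assms in auto)
  show "rho ` {0..v} \<subseteq> {0..rho_cr}"
  proof safe
    fix u assume "u \<in> {0..v}"
    then show "rho u \<in> {0..rho_cr}"
      using rho_bounds[of u] assms rho_0 rho_cr_bounds(1) by (cases "u = 0") fastforce+
  qed
qed

text \<open>The integrand of \<open>kspeed\<close> is unbounded near 0. Its primitive
  \<open>time_of_rho (rho v)\<close> is continuous on the closed interval and differentiable inside,
  so the interior form of the fundamental theorem gives integrability and value at once.\<close>

lemma kspeed_eq:
  assumes "0 \<le> v" "v < nu_cr"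
  shows "kspeed v = time_of_rho (rho v)"
proof -
  have "((\<lambda>\<mu>. sqrt (1 - 2 * (rho \<mu>)^2) / (rho \<mu>)^2) has_integral
      (time_of_rho (rho v) - time_of_rho (rho 0))) {0..v}"
    by (rule fundamental_theorem_of_calculus_interior[OF assms(1) continuous_on_time_of_rho_rho[OF assms(2)]])
      (use has_real_derivative_time_of_rho_rho assms in
        \<open>auto simp: has_real_derivative_iff_has_vector_derivative\<close>)
  then show ?thesis
    unfolding kspeed_def by (simp add: integral_unique rho_0 time_of_rho_0)
qed

lemma kspeed_bounds:
  assumes "0 < v" "v < nu_cr"
  shows "0 < kspeed v" "kspeed v < time_cr" "rho_of_time (kspeed v) = rho v"
  using rho_bounds[OF assms] time_of_rho_bounds[of "rho v"] bspec[OF rho_of_time_of_rho, of "rho v"] assms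
  by (auto simp: kspeed_eq)

lemma has_real_derivative_kspeed:
  assumes v: "0 < v" "v < nu_cr"
  shows "(kspeed has_real_derivative sqrt (1 - 2 * (rho v)\<^sup>2) / (rho v)\<^sup>2) (at v)"
  by (rule has_field_derivative_transform_within_open[OF has_real_derivative_time_of_rho_rho[OF v],
        where S = "{0<..<nu_cr}"]) (use v in \<open>auto simp: kspeed_eq\<close>)

text \<open>The target filter includes positivity of \<open>kspeed\<close>, so one-sided limits in
  the characteristic time carry over to \<nu> tending to 0 from the right.\<close>

lemma filterlim_kspeed: "filterlim kspeed (at_right 0) (at_right 0)"
proof -
  have nu: "0 < nu_cr / 2" "nu_cr / 2 < nu_cr" using nu_cr_pos by auto
  have "continuous (at 0 within {0..nu_cr / 2}) (\<lambda>v. time_of_rho (rho v))"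
    using continuous_on_time_of_rho_rho[OF nu(2)] nu(1) by (auto simp: continuous_on_eq_continuous_within)
  then have "((\<lambda>v. time_of_rho (rho v)) \<longlongrightarrow> 0) (at_right 0)"
    using nu(1) by (simp add: continuous_within rho_0 time_of_rho_0 at_within_Icc_at_right)
  moreover have ev: "\<forall>\<^sub>F v in at_right 0. 0 < v \<and> v < nu_cr"
    using eventually_at_right_real[OF nu_cr_pos] by (auto elim: eventually_mono)
  ultimately have "(kspeed \<longlongrightarrow> 0) (at_right 0)"
    by (elim Lim_transform_eventually) (auto elim!: eventually_mono simp: kspeed_eq)
  then show ?thesis
    using ev by (auto simp: filterlim_at dest: kspeed_bounds(1) elim!: eventually_mono)
qed

text \<open>
  In terms of \<open>p\<close> and \<open>q\<close> of the introduction, \<open>amp = p\<close> and \<open>pot = q\<close>, expressed through \<open>\<rho>\<close>.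
\<close>

definition pot :: "real \<Rightarrow> real" where
  "pot t = (1 - (rho_of_time t)\<^sup>2)\<^sup>2 * (3 + (rho_of_time t)\<^sup>2) / (1 - 2 * (rho_of_time t)\<^sup>2) ^ 3"

definition amp :: "real \<Rightarrow> real" where
  "amp t = rho_of_time t * (1 - 2 * (rho_of_time t)\<^sup>2) powr (- 1 / 4)"

text \<open>A closed form for the derivative of \<open>amp\<close> that stays meaningful and
  continuous at time 0, where its value is 1.\<close>

definition amp_dt :: "real \<Rightarrow> real" where
  "amp_dt t = (1 - (rho_of_time t)\<^sup>2)\<^sup>2 * (1 - 2 * (rho_of_time t)\<^sup>2) powr (- 7 / 4)"

text \<open>The coefficients contain negative powers of this quantity, which vanishes at the sonic
  density. This is why all estimates run on \<open>{0..T}\<close> with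
  \<open>T < time_cr\<close>.\<close>

lemma rho_of_time_regular:
  assumes "T < time_cr" "0 \<le> t" "t \<le> T"
  shows "0 < 1 - 2 * (rho_of_time t)\<^sup>2"
proof -
  have "0 \<le> rho_of_time t \<and> rho_of_time t < rho_cr"
    using rho_of_time_bounds[of t] rho_of_time_0 rho_cr_bounds assms by (cases "t = 0") fastforce+
  then show ?thesis using below_rho_cr(1)[of "rho_of_time t"] by auto
qed

lemma continuous_on_coefficients:
  assumes T: "T < time_cr"
  shows "continuous_on {0..T} pot" "continuous_on {0..T} amp" "continuous_on {0..T} amp_dt"
proof -
  have R: "continuous_on {0..T} rho_of_time"
    by (rule continuous_on_subset[OF rho_of_time_inverse(1)]) (use T in auto)
  have nz: "1 - 2 * (rho_of_time t)\<^sup>2 \<noteq> 0" if "t \<in> {0..T}" for t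
    using rho_of_time_regular[OF T, of t] that by auto
  show "continuous_on {0..T} pot" "continuous_on {0..T} amp" "continuous_on {0..T} amp_dt"
    unfolding pot_def amp_def amp_dt_def using nz
    by (auto intro!: continuous_intros R)
qed

lemma amp_pos: "0 < t \<Longrightarrow> t < time_cr \<Longrightarrow> 0 < amp t"
  using rho_of_time_bounds[of t] below_rho_cr(1)[of "rho_of_time t"] by (simp add: amp_def)

lemma amp_0: "amp 0 = 0" and amp_dt_0: "amp_dt 0 = 1"
  by (simp_all add: amp_def amp_dt_def rho_of_time_0)

text \<open>With \<open>z\<close> the fourth root of \<open>y\<close>, all fractional powers below
  become integer powers of \<open>z\<close>, and the derivative identities for \<open>amp\<close>
  become rational ones.\<close>

lemma powr_quarters:
  fixes y :: real assumes "0 < y"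
  defines "z \<equiv> y powr (1/4)"
  shows "0 < z" "y = z ^ 4" "sqrt y = z\<^sup>2" "y powr (-1/4) = 1 / z" "y powr (-7/4) = 1 / z ^ 7"
    "y powr (-5/4) = 1 / z ^ 5" "y powr (-11/4) = 1 / z ^ 11"
proof -
  show z: "0 < z" using assms(1) by (simp add: z_def)
  have pw: "y powr (real n / 4) = z ^ n" for n
    using z assms(1) by (simp add: z_def powr_powr flip: powr_realpow)
  have mpw: "y powr (- (real n / 4)) = 1 / z ^ n" for n
    by (simp only: powr_minus pw inverse_eq_divide)
  show y: "y = z ^ 4" using pw[of 4] assms(1) by simp
  have "y = (z\<^sup>2)\<^sup>2" using y by (simp flip: power_mult)
  then show "sqrt y = z\<^sup>2" by (intro real_sqrt_unique) auto
  show "y powr (-1/4) = 1 / z" "y powr (-7/4) = 1 / z ^ 7"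
    "y powr (-5/4) = 1 / z ^ 5" "y powr (-11/4) = 1 / z ^ 11"
    using mpw[of 1] mpw[of 7] mpw[of 5] mpw[of 11] by simp_all
qed

lemma has_real_derivative_amp:
  assumes t: "0 < t" "t < time_cr"
  shows "(amp has_real_derivative amp_dt t) (at t)"
proof -
  let ?r = "rho_of_time t"
  define y where "y = 1 - 2 * ?r\<^sup>2"
  have y: "0 < y" using below_rho_cr(1)[of ?r] rho_of_time_bounds[OF t] by (simp add: y_def)
  note z = powr_quarters[OF y]
  define z where "z = y powr (1/4)"
  have zp: "0 < z" using z(1) by (simp add: z_def)
  have rz: "?r\<^sup>2 = (1 - z ^ 4) / 2" using z(2) by (simp add: y_def z_def)
  have "((\<lambda>r. r * (1 - 2 * r\<^sup>2) powr (- 1 / 4)) has_real_derivative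
     y powr (-1/4) + ?r\<^sup>2 * y powr (-5/4)) (at ?r)"
    using y unfolding y_def
    by (auto intro!: derivative_eq_intros simp: power2_eq_square powr_diff field_simps)
  from DERIV_chain2[OF this has_real_derivative_rho_of_time[OF t]]
  have "(amp has_real_derivative (y powr (-1/4) + ?r\<^sup>2 * y powr (-5/4)) * ((1 - ?r\<^sup>2) / sqrt y)) (at t)"
    by (simp add: amp_def[abs_def] y_def)
  also have "(y powr (-1/4) + ?r\<^sup>2 * y powr (-5/4)) * ((1 - ?r\<^sup>2) / sqrt y) = amp_dt t"
  proof -
    \<comment> \<open>Since \<open>z ^ 4\<close> is \<open>1 - 2 * r^2\<close>, the two summands of
      the derivative combine, and the chain rule supplies the second factor
      \<open>1 - r^2\<close>.\<close>
    have "z ^ 4 + ?r\<^sup>2 = 1 - ?r\<^sup>2" using rz by (simp add: field_simps)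
    then have "amp_dt t = (z ^ 4 + ?r\<^sup>2) * (1 - ?r\<^sup>2) / z ^ 7"
      unfolding amp_dt_def y_def[symmetric] z(3-7) z_def[symmetric]
      by (simp add: power2_eq_square[of "1 - ?r\<^sup>2"])
    also have "\<dots> = (1 / z + ?r\<^sup>2 * (1 / z ^ 5)) * ((1 - ?r\<^sup>2) / z\<^sup>2)"
      using zp by (simp add: field_simps eval_nat_numeral)
    finally show ?thesis
      unfolding z(3-7) z_def[symmetric] by simp
  qed
  finally show ?thesis .
qed

text \<open>Together with the derivative of \<open>amp\<close> this says \<open>p'' = q p\<close>,
  the identity that makes the Wronskian argument work.\<close>

lemma has_real_derivative_amp_dt:
  assumes t: "0 < t" "t < time_cr"
  shows "(amp_dt has_real_derivative pot t * amp t) (at t)"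
proof -
  let ?r = "rho_of_time t"
  define y where "y = 1 - 2 * ?r\<^sup>2"
  have y: "0 < y" using below_rho_cr(1)[of ?r] rho_of_time_bounds[OF t] by (simp add: y_def)
  note z = powr_quarters[OF y]
  define z where "z = y powr (1/4)"
  have zp: "0 < z" using z(1) by (simp add: z_def)
  have rz: "?r\<^sup>2 = (1 - z ^ 4) / 2" using z(2) by (simp add: y_def z_def)
  have "((\<lambda>r. (1 - r\<^sup>2)\<^sup>2 * (1 - 2 * r\<^sup>2) powr (- 7 / 4)) has_real_derivative
     ?r * (7 * (1 - ?r\<^sup>2)\<^sup>2 * y powr (-11/4) - 4 * (1 - ?r\<^sup>2) * y powr (-7/4))) (at ?r)"
    using y unfolding y_def
    by (auto intro!: derivative_eq_intros simp: powr_diff field_simps)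
  from DERIV_chain2[OF this has_real_derivative_rho_of_time[OF t]]
  have "(amp_dt has_real_derivative
     ?r * (7 * (1 - ?r\<^sup>2)\<^sup>2 * y powr (-11/4) - 4 * (1 - ?r\<^sup>2) * y powr (-7/4)) * ((1 - ?r\<^sup>2) / sqrt y)) (at t)"
    by (simp add: amp_dt_def[abs_def] y_def)
  also have "?r * (7 * (1 - ?r\<^sup>2)\<^sup>2 * y powr (-11/4) - 4 * (1 - ?r\<^sup>2) * y powr (-7/4)) * ((1 - ?r\<^sup>2) / sqrt y)
      = pot t * amp t"
  proof -
    have alg: "r * (7 * a\<^sup>2 * (1 / z ^ 11) - 4 * a * (1 / z ^ 7)) * (a / z\<^sup>2)
        = a\<^sup>2 * (7 * a - 4 * z ^ 4) / (z ^ 4) ^ 3 * (r * (1 / z))" for a r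
      using zp by (simp add: field_simps eval_nat_numeral)
    \<comment> \<open>The origin of the factor \<open>3 + \<rho>^2\<close> in the potential.\<close>
    have "7 * (1 - ?r\<^sup>2) - 4 * z ^ 4 = 3 + ?r\<^sup>2" using rz by (simp add: field_simps)
    then have "pot t * amp t = (1 - ?r\<^sup>2)\<^sup>2 * (7 * (1 - ?r\<^sup>2) - 4 * z ^ 4) / (z ^ 4) ^ 3 * (?r * (1 / z))"
      unfolding pot_def amp_def y_def[symmetric] z(4) z_def[symmetric]
      by (simp add: z(2)[folded z_def, symmetric])
    then show ?thesis
      unfolding z(3,5,7) z_def[symmetric] alg by simp
  qed
  finally show ?thesis .
qed

text \<open>With \<open>p = amp\<close> the first two facts are \<open>k' = 1 / p^2\<close> and the
  wave coefficient as the square of \<open>k'\<close>. The third compares \<open>p\<close> with the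
  weight \<open>rho\<close> of the singular initial condition; the quotient tends to 1 at the
  vacuum.\<close>

lemma amp_kspeed:
  assumes v: "0 < v" "v < nu_cr"
  shows "sqrt (1 - 2 * (rho v)\<^sup>2) / (rho v)\<^sup>2 = 1 / (amp (kspeed v))\<^sup>2"
    and "wave_coef v = 1 / amp (kspeed v) ^ 4"
    and "rho v / amp (kspeed v) = (1 - 2 * (rho v)\<^sup>2) powr (1 / 4)"
proof -
  note r = rho_bounds[OF v]
  define y where "y = 1 - 2 * (rho v)\<^sup>2"
  have y: "0 < y" using below_rho_cr(1)[of "rho v"] r by (simp add: y_def)
  have r1: "0 < 1 - (rho v)\<^sup>2" using below_rho_cr(2)[of "rho v"] r by simp
  note z = powr_quarters[OF y]
  have amp: "amp (kspeed v) = rho v / y powr (1/4)"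
    using z(4) by (simp add: amp_def kspeed_bounds[OF v] y_def)
  show "sqrt (1 - 2 * (rho v)\<^sup>2) / (rho v)\<^sup>2 = 1 / (amp (kspeed v))\<^sup>2"
    unfolding amp y_def[symmetric] z(3) by (simp add: power_divide)
  show "rho v / amp (kspeed v) = (1 - 2 * (rho v)\<^sup>2) powr (1 / 4)"
    unfolding amp y_def[symmetric] using r by simp
  have "wave_coef v = y / rho v ^ 4"
    using r r1 unfolding wave_coef_def mach_def y_def
    by (simp add: power_divide field_simps eval_nat_numeral)
  also have "\<dots> = 1 / amp (kspeed v) ^ 4"
    unfolding amp power_divide z(2)[symmetric] by simp
  finally show "wave_coef v = 1 / amp (kspeed v) ^ 4" .
qed

section \<open>From the regular wave equation back to the degenerate one\<close>

lemma continuous_on_Icc_abs_bounded: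
  fixes f :: "real \<Rightarrow> real"
  assumes "continuous_on {a..b} f"
  obtains B where "\<And>x. x \<in> {a..b} \<Longrightarrow> \<bar>f x\<bar> \<le> B"
proof -
  have "bounded (f ` {a..b})"
    by (intro compact_imp_bounded compact_continuous_image assms) simp
  then have "\<exists>B. \<forall>x\<in>{a..b}. \<bar>f x\<bar> \<le> B" by (auto simp: bounded_iff)
  then show ?thesis using that by blast
qed

section \<open>Test functions, their derivatives and supports\<close>

lemma test_fun_has_real_derivative:
  assumes "test_fun \<psi>" shows "(\<psi> has_real_derivative deriv \<psi> x) (at x)"
proof -
  have "((deriv ^^ 0) \<psi>) differentiable (at x)" using assms unfolding test_fun_def by blast
  then show ?thesis by (simp add: DERIV_deriv_iff_real_differentiable)
qed

lemma continuous_on_test_fun: "test_fun \<psi> \<Longrightarrow> continuous_on S \<psi>"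
  by (meson DERIV_isCont continuous_at_imp_continuous_on test_fun_has_real_derivative)

text \<open>Off the closed support, \<open>\<psi>\<close> vanishes on an open neighbourhood of the
  point, hence has derivative 0 there.\<close>

lemma deriv_nonzero_subset: "{x. deriv \<psi> x \<noteq> 0} \<subseteq> closure {x. \<psi> x \<noteq> (0::real)}"
proof
  fix x :: real assume x: "x \<in> {x. deriv \<psi> x \<noteq> 0}"
  show "x \<in> closure {x. \<psi> x \<noteq> 0}"
  proof (rule ccontr)
    assume "x \<notin> closure {x. \<psi> x \<noteq> 0}"
    then have "x \<in> - closure {x. \<psi> x \<noteq> 0}" by simp
    have "((\<lambda>_. 0) has_real_derivative 0) (at x)" by simp
    then have "(\<psi> has_real_derivative 0) (at x)"
      by (rule has_field_derivative_transform_within_open[where S = "- closure {x. \<psi> x \<noteq> 0}"])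
        (use \<open>x \<in> - closure _\<close> closure_subset[of "{x. \<psi> x \<noteq> 0}"] in auto)
    then show False using x DERIV_imp_deriv by blast
  qed
qed

lemma closure_deriv_nonzero_subset: "closure {x. deriv \<psi> x \<noteq> 0} \<subseteq> closure {x. \<psi> x \<noteq> (0::real)}"
  by (intro closure_minimal deriv_nonzero_subset closed_closure)

lemma test_fun_deriv:
  assumes "test_fun \<psi>" shows "test_fun (deriv \<psi>)"
  unfolding test_fun_def
proof
  have "(deriv ^^ n) (deriv \<psi>) = (deriv ^^ Suc n) \<psi>" for n
    by (simp add: funpow_swap1)
  then show "\<forall>n x. ((deriv ^^ n) (deriv \<psi>)) differentiable (at x)"
    using assms unfolding test_fun_def by metis
  from assms obtain R where R: "\<And>x. R < \<bar>x\<bar> \<Longrightarrow> \<psi> x = 0" unfolding test_fun_def by blast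
  have "closure {x. \<psi> x \<noteq> 0} \<subseteq> {-R..R}"
  proof (rule closure_minimal)
    show "{x. \<psi> x \<noteq> 0} \<subseteq> {-R..R}"
    proof
      fix x assume "x \<in> {x. \<psi> x \<noteq> 0}"
      then show "x \<in> {-R..R}" using R[of x] by (cases "R < \<bar>x\<bar>") auto
    qed
  qed simp
  then have "{x. deriv \<psi> x \<noteq> 0} \<subseteq> {-R..R}" using deriv_nonzero_subset by blast
  then show "\<exists>R. \<forall>x. R < \<bar>x\<bar> \<longrightarrow> deriv \<psi> x = 0"
    by (intro exI[of _ R]) (auto simp: subset_iff abs_if split: if_splits)
qed

lemma test_fun_abs_le_Sup:
  assumes "test_fun \<psi>" shows "\<bar>\<psi> x\<bar> \<le> Sup (range (\<lambda>x. \<bar>\<psi> x\<bar>))"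
proof (rule cSup_upper)
  from assms obtain R where R: "\<And>x. R < \<bar>x\<bar> \<Longrightarrow> \<psi> x = 0" unfolding test_fun_def by blast
  obtain b where b: "\<And>x. x \<in> {-R..R} \<Longrightarrow> \<bar>\<psi> x\<bar> \<le> b"
    using continuous_on_Icc_abs_bounded[OF continuous_on_test_fun[OF assms]] by blast
  have "\<bar>\<psi> x\<bar> \<le> max b 0" for x
    using b[of x] R[of x] by (cases "x \<in> {-R..R}") auto
  then show "bdd_above (range (\<lambda>x. \<bar>\<psi> x\<bar>))" by (auto intro!: bdd_aboveI)
qed auto

text \<open>The right-hand side in \<open>distribution\<close> for \<open>N = 2\<close>: the
  singular datum \<open>- \<delta>_0''\<close> costs two derivatives of the test function.\<close>

definition c2_norm :: "(real \<Rightarrow> real) \<Rightarrow> real" where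
  "c2_norm \<psi> = (\<Sum>j\<le>2. Sup (range (\<lambda>x. \<bar>(deriv ^^ j) \<psi> x\<bar>)))"

lemma abs_le_c2_norm:
  assumes "test_fun \<psi>"
  shows "\<bar>\<psi> x\<bar> \<le> c2_norm \<psi>" "\<bar>deriv (deriv \<psi>) x\<bar> \<le> c2_norm \<psi>" "0 \<le> c2_norm \<psi>"
proof -
  note le = test_fun_abs_le_Sup[OF assms] test_fun_abs_le_Sup[OF test_fun_deriv[OF assms]]
    test_fun_abs_le_Sup[OF test_fun_deriv[OF test_fun_deriv[OF assms]]]
  have "c2_norm \<psi> = Sup (range (\<lambda>x. \<bar>\<psi> x\<bar>)) + Sup (range (\<lambda>x. \<bar>deriv \<psi> x\<bar>))
      + Sup (range (\<lambda>x. \<bar>deriv (deriv \<psi>) x\<bar>))"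
    by (simp add: c2_norm_def eval_nat_numeral)
  with le(1)[of x] le(2)[of x] le(3)[of x]
  show "\<bar>\<psi> x\<bar> \<le> c2_norm \<psi>" "\<bar>deriv (deriv \<psi>) x\<bar> \<le> c2_norm \<psi>" "0 \<le> c2_norm \<psi>"
    by linarith+
qed

text \<open>\<open>J \<psi> t x\<close> stands for the free wave with the initial data of
  \<open>v\<close>, at time \<open>t\<close>, tested against \<open>\<psi>\<close> translated by
  \<open>x\<close>. Only \<open>x = 0\<close> matters in the end, but the Duhamel triangle visits
  other \<open>x\<close>. The functional \<open>c\<close> is the value of \<open>H\<close> at time
  0, and \<open>c_deriv_deriv\<close> is the compatibility condition that fixes the constant of
  integration in the Wronskian identity.\<close>

locale wave_data =
  fixes J :: "(real \<Rightarrow> real) \<Rightarrow> real \<Rightarrow> real \<Rightarrow> real"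
    and J_dt :: "(real \<Rightarrow> real) \<Rightarrow> real \<Rightarrow> real"
    and c :: "(real \<Rightarrow> real) \<Rightarrow> real"
  assumes strip_cont_J: "test_fun \<psi> \<Longrightarrow> strip_cont T (J \<psi>)"
    and abs_J_le: "test_fun \<psi> \<Longrightarrow> 0 \<le> t \<Longrightarrow> t \<le> T \<Longrightarrow> \<bar>J \<psi> t x\<bar> \<le> (1 + T) * c2_norm \<psi>"
    and J_add_cmult: "test_fun \<psi> \<Longrightarrow> test_fun \<phi> \<Longrightarrow>
      J (\<lambda>x. a * \<psi> x + b * \<phi> x) = (\<lambda>t x. a * J \<psi> t x + b * J \<phi> t x)"
    and J_dx: "test_fun \<psi> \<Longrightarrow> (J \<psi> t has_real_derivative J (deriv \<psi>) t x) (at x)"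
    and J_dt: "test_fun \<psi> \<Longrightarrow> ((\<lambda>t. J \<psi> t 0) has_real_derivative J_dt \<psi> t) (at t)"
    and J_dtt: "test_fun \<psi> \<Longrightarrow> (J_dt \<psi> has_real_derivative J (deriv (deriv \<psi>)) t 0) (at t)"
    and J_eq_0: "test_fun \<psi> \<Longrightarrow> closure {x. \<psi> x \<noteq> 0} \<inter> {-L..L} = {} \<Longrightarrow>
      0 \<le> s \<Longrightarrow> s + \<bar>y\<bar> \<le> L \<Longrightarrow> J \<psi> s y = 0"
    and c_add_cmult: "test_fun \<psi> \<Longrightarrow> test_fun \<phi> \<Longrightarrow> c (\<lambda>x. a * \<psi> x + b * \<phi> x) = a * c \<psi> + b * c \<phi>"
    and abs_c_le: "test_fun \<psi> \<Longrightarrow> \<bar>c \<psi>\<bar> \<le> c2_norm \<psi>"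
    and c_eq_0: "test_fun \<psi> \<Longrightarrow> \<psi> 0 = 0 \<Longrightarrow> c \<psi> = 0"
    and c_deriv_deriv: "test_fun \<psi> \<Longrightarrow> c (deriv (deriv \<psi>)) = - J \<psi> 0 0"
begin

definition V :: "(real \<Rightarrow> real) \<Rightarrow> real \<Rightarrow> real" where
  "V \<psi> t = wave_sol pot (J \<psi>) t 0"

definition V_dt :: "(real \<Rightarrow> real) \<Rightarrow> real \<Rightarrow> real" where
  "V_dt \<psi> t = J_dt \<psi> t + duhamel_dt pot (wave_sol pot (J \<psi>)) t 0"

definition h :: "(real \<Rightarrow> real) \<Rightarrow> real \<Rightarrow> real" where
  "h \<psi> t = c \<psi> + integral {0..t} (\<lambda>\<tau>. amp \<tau> * V \<psi> \<tau>)"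

definition H :: "real \<Rightarrow> (real \<Rightarrow> real) \<Rightarrow> real" where
  "H v \<psi> = h \<psi> (kspeed v)"

lemma pot_bounded:
  assumes "T < time_cr"
  obtains B where "\<And>t. 0 \<le> t \<Longrightarrow> t \<le> T \<Longrightarrow> \<bar>pot t\<bar> \<le> B"
  using continuous_on_Icc_abs_bounded[OF continuous_on_coefficients(1)[OF assms]]
  by (metis atLeastAtMost_iff)

lemma strip_cont_wave_sol_J:
  assumes T: "T < time_cr" and \<psi>: "test_fun \<psi>"
  shows "strip_cont T (wave_sol pot (J \<psi>))"
proof -
  obtain B where B: "\<And>t. 0 \<le> t \<Longrightarrow> t \<le> T \<Longrightarrow> \<bar>pot t\<bar> \<le> B" using pot_bounded[OF T] by blast
  show ?thesis
    by (rule strip_cont_wave_sol[OF continuous_on_coefficients(1)[OF T] B strip_cont_J[OF \<psi>] abs_J_le[OF \<psi>]])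
qed

lemma continuous_on_V:
  assumes T: "T < time_cr" and \<psi>: "test_fun \<psi>"
  shows "continuous_on {0..T} (V \<psi>)"
proof -
  have "continuous_on {0..T} (\<lambda>t. wave_sol pot (J \<psi>) t 0)"
    by (intro strip_cont_compose[OF strip_cont_wave_sol_J[OF T \<psi>]] continuous_intros) auto
  then show ?thesis by (simp add: V_def[abs_def])
qed

lemma continuous_on_V_dt:
  assumes T: "T < time_cr" and \<psi>: "test_fun \<psi>"
  shows "continuous_on {0..T} (V_dt \<psi>)"
proof -
  have "continuous_on {0..T} (J_dt \<psi>)"
    using J_dtt[OF \<psi>] by (meson DERIV_isCont continuous_at_imp_continuous_on)
  moreover have "continuous_on {0..T} (\<lambda>t. duhamel_dt pot (wave_sol pot (J \<psi>)) t 0)"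
    by (intro continuous_on_duhamel_dt continuous_on_coefficients T strip_cont_wave_sol_J \<psi>)
  ultimately show ?thesis unfolding V_dt_def[abs_def] by (rule continuous_on_add)
qed

lemma has_real_derivative_V:
  assumes t: "0 < t" "t < time_cr" and \<psi>: "test_fun \<psi>"
  shows "(V \<psi> has_real_derivative V_dt \<psi> t) (at t)"
proof -
  \<comment> \<open>Any \<open>T\<close> strictly between \<open>t\<close> and
    \<open>time_cr\<close> would do: it makes \<open>t\<close> interior to the time interval while
    the potential stays bounded.\<close>
  define T where "T = (t + time_cr) / 2"
  have T: "T < time_cr" "t < T" using t by (auto simp: T_def)
  obtain B where B: "\<And>t. 0 \<le> t \<Longrightarrow> t \<le> T \<Longrightarrow> \<bar>pot t\<bar> \<le> B" using pot_bounded[OF T(1)] by blast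
  show ?thesis
    unfolding V_def[abs_def] V_dt_def
    by (rule has_real_derivative_wave_sol_time[OF continuous_on_coefficients(1)[OF T(1)] B
          strip_cont_J[OF \<psi>] abs_J_le[OF \<psi>] J_dt[OF \<psi>] t(1) T(2)])
qed

lemma has_real_derivative_V_dt:
  assumes t: "0 < t" "t < time_cr" and \<psi>: "test_fun \<psi>"
  shows "(V_dt \<psi> has_real_derivative pot t * V \<psi> t + V (deriv (deriv \<psi>)) t) (at t)"
proof -
  define T where "T = (t + time_cr) / 2"
  have T: "T < time_cr" "t < T" using t by (auto simp: T_def)
  obtain B where B: "\<And>t. 0 \<le> t \<Longrightarrow> t \<le> T \<Longrightarrow> \<bar>pot t\<bar> \<le> B" using pot_bounded[OF T(1)] by blast
  note \<psi>' = test_fun_deriv[OF \<psi>]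
  note \<psi>'' = test_fun_deriv[OF \<psi>']
  show ?thesis
    unfolding V_def V_dt_def[abs_def]
    by (rule has_real_derivative_wave_sol_time_dt[OF continuous_on_coefficients(1)[OF T(1)] B
          strip_cont_J[OF \<psi>] abs_J_le[OF \<psi>] strip_cont_J[OF \<psi>'] abs_J_le[OF \<psi>']
          strip_cont_J[OF \<psi>''] abs_J_le[OF \<psi>''] J_dx[OF \<psi>] J_dx[OF \<psi>'] J_dtt[OF \<psi>] t(1) T(2)])
qed

lemma V_0:
  assumes \<psi>: "test_fun \<psi>" shows "V \<psi> 0 = J \<psi> 0 0"
proof -
  \<comment> \<open>A strip of height 0 suffices here; the prefactor \<open>t\<close> in
    \<open>duhamel\<close> then removes the integral term.\<close>
  note T = time_cr_pos
  obtain B where B: "\<And>t. 0 \<le> t \<Longrightarrow> t \<le> 0 \<Longrightarrow> \<bar>pot t\<bar> \<le> B" using pot_bounded[OF T] by blast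
  have "wave_sol pot (J \<psi>) 0 0 = J \<psi> 0 0 + duhamel pot (wave_sol pot (J \<psi>)) 0 0"
    by (rule wave_sol_fixpoint[OF continuous_on_coefficients(1)[OF T] B
          strip_cont_J[OF \<psi>] abs_J_le[OF \<psi>]]) auto
  then show ?thesis by (simp add: V_def duhamel_def)
qed

lemma V_dt_0: "V_dt \<psi> 0 = J_dt \<psi> 0"
  by (simp add: V_dt_def duhamel_dt_def)

lemma continuous_on_amp_V:
  assumes "T < time_cr" "test_fun \<psi>"
  shows "continuous_on {0..T} (\<lambda>\<tau>. amp \<tau> * V \<psi> \<tau>)"
  by (intro continuous_on_mult continuous_on_coefficients continuous_on_V assms)

lemma has_real_derivative_h:
  assumes t: "0 < t" "t < time_cr" and \<psi>: "test_fun \<psi>"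
  shows "(h \<psi> has_real_derivative amp t * V \<psi> t) (at t)"
proof -
  define T where "T = (t + time_cr) / 2"
  have T: "T < time_cr" "t < T" using t by (auto simp: T_def)
  have "((\<lambda>t. integral {0..t} (\<lambda>\<tau>. amp \<tau> * V \<psi> \<tau>)) has_real_derivative amp t * V \<psi> t) (at t within {0..T})"
    by (rule integral_has_real_derivative[OF continuous_on_amp_V[OF T(1) \<psi>]]) (use t T in auto)
  moreover have "at t within {0..T} = at t"
    using t T by (intro at_within_interior) auto
  ultimately have "((\<lambda>t. integral {0..t} (\<lambda>\<tau>. amp \<tau> * V \<psi> \<tau>)) has_real_derivative amp t * V \<psi> t) (at t)"
    by (simp only:)
  from DERIV_add[OF DERIV_const this] show ?thesis
    by (simp add: h_def[abs_def])
qed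

text \<open>On differentiation the terms with \<open>pot\<close> cancel, because \<open>amp\<close>
  solves the same equation without the space derivative, and
  \<open>amp * V (deriv (deriv \<psi>))\<close> remains. At time 0 the Wronskian is
  \<open>- V \<psi> 0\<close>, which compatibility identifies with
  \<open>c (deriv (deriv \<psi>))\<close>.\<close>

lemma wronskian:
  assumes t: "0 < t" "t < time_cr" and \<psi>: "test_fun \<psi>"
  shows "amp t * V_dt \<psi> t - amp_dt t * V \<psi> t = h (deriv (deriv \<psi>)) t"
proof -
  let ?Z = "\<lambda>t. amp t * V_dt \<psi> t - amp_dt t * V \<psi> t"
  have "((\<lambda>\<tau>. amp \<tau> * V (deriv (deriv \<psi>)) \<tau>) has_integral (?Z t - ?Z 0)) {0..t}"
  proof (rule fundamental_theorem_of_calculus_interior)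
    show "continuous_on {0..t} ?Z"
      by (intro continuous_intros continuous_on_coefficients continuous_on_V continuous_on_V_dt t \<psi>)
    fix s assume "s \<in> {0<..<t}"
    then have s: "0 < s" "s < time_cr" using t by auto
    have "(?Z has_real_derivative
       (amp_dt s * V_dt \<psi> s + (pot s * V \<psi> s + V (deriv (deriv \<psi>)) s) * amp s)
       - (pot s * amp s * V \<psi> s + V_dt \<psi> s * amp_dt s)) (at s)"
      by (intro DERIV_diff DERIV_mult has_real_derivative_amp has_real_derivative_amp_dt
          has_real_derivative_V has_real_derivative_V_dt s \<psi>)
    then have "(?Z has_real_derivative amp s * V (deriv (deriv \<psi>)) s) (at s)"
      by (simp add: algebra_simps)
    then show "(?Z has_vector_derivative amp s * V (deriv (deriv \<psi>)) s) (at s)"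
      by (simp add: has_real_derivative_iff_has_vector_derivative)
  qed (use t in auto)
  from integral_unique[OF this]
  have "integral {0..t} (\<lambda>\<tau>. amp \<tau> * V (deriv (deriv \<psi>)) \<tau>) = ?Z t - ?Z 0" .
  then show ?thesis
    using V_0[OF \<psi>] c_deriv_deriv[OF \<psi>] unfolding h_def by (simp add: amp_0 amp_dt_0)
qed

text \<open>Chain rule: \<open>h\<close> contributes \<open>amp * V\<close> and \<open>k'\<close>
  contributes \<open>1 / amp^2\<close>.\<close>

lemma has_real_derivative_H:
  assumes v: "0 < v" "v < nu_cr" and \<psi>: "test_fun \<psi>"
  shows "((\<lambda>v. H v \<psi>) has_real_derivative V \<psi> (kspeed v) / amp (kspeed v)) (at v)"
proof -
  note k = kspeed_bounds[OF v]
  have "((\<lambda>v. H v \<psi>) has_real_derivative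
      amp (kspeed v) * V \<psi> (kspeed v) * (1 / (amp (kspeed v))\<^sup>2)) (at v)"
    using DERIV_chain2[OF has_real_derivative_h[OF k(1,2) \<psi>] has_real_derivative_kspeed[OF v]]
    unfolding H_def amp_kspeed(1)[OF v] .
  then show ?thesis
    using amp_pos[OF k(1,2)] by (simp add: power2_eq_square)
qed

text \<open>The quotient rule gives the Wronskian over \<open>amp^2\<close>, and \<open>k'\<close>
  gives another \<open>1 / amp^2\<close>. The product of the two denominators is the wave
  coefficient, and the Wronskian is \<open>H\<close> tested against the second derivative.\<close>

lemma has_real_derivative_H_deriv:
  assumes v: "0 < v" "v < nu_cr" and \<psi>: "test_fun \<psi>"
  shows "((\<lambda>v. V \<psi> (kspeed v) / amp (kspeed v)) has_real_derivative
    wave_coef v * H v (deriv (deriv \<psi>))) (at v)"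
proof -
  note k = kspeed_bounds[OF v]
  have nz: "amp (kspeed v) \<noteq> 0" using amp_pos[OF k(1,2)] by simp
  let ?k = "kspeed v"
  have "((\<lambda>t. V \<psi> t / amp t) has_real_derivative
      (V_dt \<psi> ?k * amp ?k - V \<psi> ?k * amp_dt ?k) / (amp ?k * amp ?k)) (at ?k)"
    by (intro DERIV_divide has_real_derivative_V has_real_derivative_amp k \<psi> nz)
  from DERIV_chain2[OF this has_real_derivative_kspeed[OF v]]
  have "((\<lambda>v. V \<psi> (kspeed v) / amp (kspeed v)) has_real_derivative
      (V_dt \<psi> ?k * amp ?k - V \<psi> ?k * amp_dt ?k) / (amp ?k * amp ?k) * (1 / (amp ?k)\<^sup>2)) (at v)"
    unfolding amp_kspeed(1)[OF v] .
  also have "(V_dt \<psi> ?k * amp ?k - V \<psi> ?k * amp_dt ?k) / (amp ?k * amp ?k) * (1 / (amp ?k)\<^sup>2)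
      = wave_coef v * H v (deriv (deriv \<psi>))"
    unfolding amp_kspeed(2)[OF v] H_def wronskian[OF k(1,2) \<psi>, symmetric]
    by (simp add: eval_nat_numeral mult_ac)
  finally show ?thesis .
qed

lemma deriv_H:
  assumes "0 < v" "v < nu_cr" "test_fun \<psi>"
  shows "deriv (\<lambda>v. H v \<psi>) v = V \<psi> (kspeed v) / amp (kspeed v)"
  using DERIV_imp_deriv[OF has_real_derivative_H[OF assms]] .

text \<open>Finite speed with \<open>L = t\<close> covers all times up to \<open>t\<close> in the
  integral. The term \<open>c \<psi>\<close> vanishes because 0 lies in the interval that the
  support avoids.\<close>

lemma h_eq_0:
  assumes \<psi>: "test_fun \<psi>" and supp: "closure {x. \<psi> x \<noteq> 0} \<inter> {-t..t} = {}" and t: "0 \<le> t"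
  shows "h \<psi> t = 0"
proof -
  have "V \<psi> s = 0" if "s \<in> {0..t}" for s
    unfolding V_def by (rule wave_sol_eq_0[OF J_eq_0[OF \<psi> supp]]) (use that in auto)
  then have "integral {0..t} (\<lambda>\<tau>. amp \<tau> * V \<psi> \<tau>) = integral {0..t} (\<lambda>_. 0)"
    by (intro integral_cong) simp
  moreover have "\<psi> 0 = 0"
    using supp t closure_subset[of "{x. \<psi> x \<noteq> 0}"] by auto
  ultimately show ?thesis by (simp add: h_def c_eq_0[OF \<psi>])
qed

lemma h_add_cmult:
  assumes t: "0 < t" "t < time_cr" and \<psi>: "test_fun \<psi>" and \<phi>: "test_fun \<phi>"
  shows "h (\<lambda>x. a * \<psi> x + b * \<phi> x) t = a * h \<psi> t + b * h \<phi> t"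
proof -
  obtain B where B: "\<And>s. 0 \<le> s \<Longrightarrow> s \<le> t \<Longrightarrow> \<bar>pot s\<bar> \<le> B" using pot_bounded[OF t(2)] by blast
  have V: "V (\<lambda>x. a * \<psi> x + b * \<phi> x) s = a * V \<psi> s + b * V \<phi> s" if "s \<in> {0..t}" for s
    unfolding V_def J_add_cmult[OF \<psi> \<phi>]
    by (rule wave_sol_add_cmult[OF continuous_on_coefficients(1)[OF t(2)] B strip_cont_J[OF \<psi>]
          abs_J_le[OF \<psi>] strip_cont_J[OF \<phi>] abs_J_le[OF \<phi>]]) (use that in auto)
  have int: "(\<lambda>\<tau>. amp \<tau> * V \<psi> \<tau>) integrable_on {0..t}" "(\<lambda>\<tau>. amp \<tau> * V \<phi> \<tau>) integrable_on {0..t}"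
    by (intro integrable_continuous_real continuous_on_amp_V t \<psi> \<phi>)+
  have "integral {0..t} (\<lambda>\<tau>. amp \<tau> * V (\<lambda>x. a * \<psi> x + b * \<phi> x) \<tau>)
      = integral {0..t} (\<lambda>\<tau>. a * (amp \<tau> * V \<psi> \<tau>) + b * (amp \<tau> * V \<phi> \<tau>))"
    by (intro integral_cong) (simp add: V algebra_simps)
  also have "\<dots> = integral {0..t} (\<lambda>\<tau>. a * (amp \<tau> * V \<psi> \<tau>)) + integral {0..t} (\<lambda>\<tau>. b * (amp \<tau> * V \<phi> \<tau>))"
    by (intro integral_add integrable_on_mult_right int)
  also have "\<dots> = a * integral {0..t} (\<lambda>\<tau>. amp \<tau> * V \<psi> \<tau>) + b * integral {0..t} (\<lambda>\<tau>. amp \<tau> * V \<phi> \<tau>)"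
    by simp
  finally show ?thesis
    unfolding h_def c_add_cmult[OF \<psi> \<phi>] by (simp add: algebra_simps)
qed

lemma abs_h_le:
  assumes t: "0 < t" "t < time_cr"
  obtains C where "\<And>\<psi>. test_fun \<psi> \<Longrightarrow> \<bar>h \<psi> t\<bar> \<le> C * c2_norm \<psi>"
proof -
  obtain B where B: "\<And>s. 0 \<le> s \<Longrightarrow> s \<le> t \<Longrightarrow> \<bar>pot s\<bar> \<le> B" using pot_bounded[OF t(2)] by blast
  obtain D where D: "\<And>s. s \<in> {0..t} \<Longrightarrow> \<bar>amp s\<bar> \<le> D"
    using continuous_on_Icc_abs_bounded[OF continuous_on_coefficients(2)[OF t(2)]] by blast
  \<comment> \<open>The factor \<open>1 + t\<close> comes from the bound on \<open>J\<close>, the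
    exponential from summing the Picard majorants.\<close>
  define E where "E = (1 + t) * exp (B * t * t)"
  have "\<bar>h \<psi> t\<bar> \<le> (1 + D * E * t) * c2_norm \<psi>" if \<psi>: "test_fun \<psi>" for \<psi>
  proof -
    have V: "\<bar>V \<psi> s\<bar> \<le> E * c2_norm \<psi>" if "s \<in> {0..t}" for s
    proof -
      have "\<bar>V \<psi> s\<bar> \<le> (1 + t) * c2_norm \<psi> * exp (B * t * t)"
        unfolding V_def
        by (rule abs_wave_sol_le[OF continuous_on_coefficients(1)[OF t(2)] B strip_cont_J[OF \<psi>]
              abs_J_le[OF \<psi>]]) (use that in auto)
      then show ?thesis by (simp add: E_def mult_ac)
    qed
    have "norm (integral {0..t} (\<lambda>\<tau>. amp \<tau> * V \<psi> \<tau>)) \<le> (D * (E * c2_norm \<psi>)) * (t - 0)"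
    proof (rule integral_bound)
      show "continuous_on {0..t} (\<lambda>\<tau>. amp \<tau> * V \<psi> \<tau>)" by (rule continuous_on_amp_V[OF t(2) \<psi>])
      fix s assume s: "s \<in> {0..t}"
      have "\<bar>amp s\<bar> * \<bar>V \<psi> s\<bar> \<le> D * (E * c2_norm \<psi>)"
        using D[OF s] V[OF s] by (intro mult_mono) auto
      then show "norm (amp s * V \<psi> s) \<le> D * (E * c2_norm \<psi>)" by (simp add: abs_mult)
    qed (use t in simp)
    then show ?thesis
      using abs_c_le[OF \<psi>] abs_triangle_ineq[of "c \<psi>" "integral {0..t} (\<lambda>\<tau>. amp \<tau> * V \<psi> \<tau>)"]
      unfolding h_def by (simp add: algebra_simps)
  qed
  then show ?thesis using that by blast
qed

lemma cone_wave_solution_H: "cone_wave_solution H"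
  unfolding cone_wave_solution_def
proof (intro conjI ballI allI impI)
  fix v assume "v \<in> {0<..<nu_cr}"
  then have v: "0 < v" "v < nu_cr" by auto
  note k = kspeed_bounds[OF v]
  show "distribution (H v)"
    unfolding distribution_def H_def
  proof (intro conjI allI impI)
    show "h (\<lambda>x. a * \<psi> x + b * \<phi> x) (kspeed v) = a * h \<psi> (kspeed v) + b * h \<phi> (kspeed v)"
      if "test_fun \<psi>" "test_fun \<phi>" for \<psi> \<phi> a b
      by (rule h_add_cmult[OF k(1,2) that])
    \<comment> \<open>This constant does not depend on the support of the test function, so the same
      \<open>C\<close>, with \<open>N = 2\<close>, serves every radius \<open>R\<close>.\<close>
    obtain C where "\<And>\<psi>. test_fun \<psi> \<Longrightarrow> \<bar>h \<psi> (kspeed v)\<bar> \<le> C * c2_norm \<psi>"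
      using abs_h_le[OF k(1,2)] by blast
    then show "\<exists>C N. \<forall>\<psi>. test_fun \<psi> \<and> (\<forall>x. R < \<bar>x\<bar> \<longrightarrow> \<psi> x = 0) \<longrightarrow>
        \<bar>h \<psi> (kspeed v)\<bar> \<le> C * (\<Sum>j\<le>N. Sup (range (\<lambda>x. \<bar>(deriv ^^ j) \<psi> x\<bar>)))" for R
      unfolding c2_norm_def by blast
  qed
  show "supp_in (H v) {- kspeed v..kspeed v}"
    unfolding supp_in_def H_def using h_eq_0 k by auto
next
  fix \<psi> v assume \<psi>: "test_fun \<psi>" and "v \<in> {0<..<nu_cr}"
  then have v: "0 < v" "v < nu_cr" by auto
  show "(\<lambda>\<mu>. H \<mu> \<psi>) differentiable (at v)"
    using has_real_derivative_H[OF v \<psi>] by (auto simp: real_differentiable_def)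
  \<comment> \<open>The formula for the first derivative holds on the whole open interval, so it may
    be differentiated once more at \<open>v\<close>.\<close>
  have "(deriv (\<lambda>\<mu>. H \<mu> \<psi>) has_real_derivative wave_coef v * H v (deriv (deriv \<psi>))) (at v)"
    by (rule has_field_derivative_transform_within_open[OF has_real_derivative_H_deriv[OF v \<psi>],
          where S = "{0<..<nu_cr}"]) (use v in \<open>auto simp: deriv_H \<psi>\<close>)
  then show "(deriv (\<lambda>\<mu>. H \<mu> \<psi>)) differentiable (at v)"
    and "deriv (deriv (\<lambda>\<mu>. H \<mu> \<psi>)) v - wave_coef v * H v (deriv (deriv \<psi>)) = 0"
    by (auto simp: real_differentiable_def dest: DERIV_imp_deriv)
qed

end

section \<open>Initial values as limits for \<nu> tending to 0 from the right\<close>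

lemma tendsto_at_right_0:
  fixes f :: "real \<Rightarrow> real"
  assumes "continuous_on {0..T} f" "0 < T"
  shows "(f \<longlongrightarrow> f 0) (at_right 0)"
proof -
  have "continuous (at 0 within {0..T}) f"
    using assms by (auto simp: continuous_on_eq_continuous_within)
  then show ?thesis
    using assms(2) by (simp add: continuous_within at_within_Icc_at_right)
qed

lemma eventually_at_right_0_less: "0 < (b::real) \<Longrightarrow> \<forall>\<^sub>F v in at_right 0. 0 < v \<and> v < b"
  using eventually_at_right_real[of 0 b] by (auto elim: eventually_mono)

context wave_data
begin

lemma tendsto_H:
  assumes \<psi>: "test_fun \<psi>" shows "((\<lambda>v. H v \<psi>) \<longlongrightarrow> c \<psi>) (at_right 0)"
proof -
  have T: "time_cr / 2 < time_cr" "0 < time_cr / 2" using time_cr_pos by auto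
  have "continuous_on {0..time_cr / 2} (h \<psi>)"
    unfolding h_def[abs_def]
    by (intro continuous_on_add continuous_on_const indefinite_integral_continuous_1
        integrable_continuous_real continuous_on_amp_V T \<psi>)
  from tendsto_at_right_0[OF this T(2)] have "(h \<psi> \<longlongrightarrow> c \<psi>) (at_right 0)"
    by (simp add: h_def)
  from filterlim_compose[OF this filterlim_kspeed] show ?thesis by (simp add: H_def)
qed

lemma tendsto_V:
  assumes \<psi>: "test_fun \<psi>" shows "(V \<psi> \<longlongrightarrow> J \<psi> 0 0) (at_right 0)"
  using tendsto_at_right_0[OF continuous_on_V[OF _ \<psi>], of "time_cr / 2"] time_cr_pos V_0[OF \<psi>] by simp

text \<open>The derivative of \<open>H\<close> is \<open>V / amp\<close>, of the form 0/0 at time 0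
  because of \<open>J0\<close>. L'Hospital's rule applies with quotient
  \<open>V_dt / amp_dt\<close>, whose denominator tends to 1.\<close>

lemma tendsto_deriv_H:
  assumes \<psi>: "test_fun \<psi>" and J0: "J \<psi> 0 0 = 0"
  shows "((\<lambda>v. deriv (\<lambda>\<mu>. H \<mu> \<psi>) v) \<longlongrightarrow> J_dt \<psi> 0) (at_right 0)"
proof -
  have T: "time_cr / 2 < time_cr" "0 < time_cr / 2" using time_cr_pos by auto
  note ev = eventually_at_right_0_less[OF time_cr_pos]
  have amp_dt: "(amp_dt \<longlongrightarrow> 1) (at_right 0)"
    using tendsto_at_right_0[OF continuous_on_coefficients(3)[OF T(1)] T(2)] by (simp add: amp_dt_0)
  have "(V \<psi> \<longlongrightarrow> 0) (at_right 0)" using tendsto_V[OF \<psi>] J0 by simp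
  moreover have "(amp \<longlongrightarrow> 0) (at_right 0)"
    using tendsto_at_right_0[OF continuous_on_coefficients(2)[OF T(1)] T(2)] by (simp add: amp_0)
  moreover have "\<forall>\<^sub>F t in at_right 0. amp t \<noteq> 0"
    using ev by (rule eventually_mono) (use amp_pos in force)
  moreover from amp_dt have "\<forall>\<^sub>F t in at_right 0. amp_dt t \<noteq> 0"
    by (rule tendsto_imp_eventually_ne) simp
  moreover have "\<forall>\<^sub>F t in at_right 0. (V \<psi> has_real_derivative V_dt \<psi> t) (at t)"
    using ev by (rule eventually_mono) (use has_real_derivative_V \<psi> in auto)
  moreover have "\<forall>\<^sub>F t in at_right 0. (amp has_real_derivative amp_dt t) (at t)"
    using ev by (rule eventually_mono) (use has_real_derivative_amp in auto)
  moreover have "((\<lambda>t. V_dt \<psi> t / amp_dt t) \<longlongrightarrow> J_dt \<psi> 0 / 1) (at_right 0)"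
    using tendsto_at_right_0[OF continuous_on_V_dt[OF T(1) \<psi>] T(2)] amp_dt
    by (intro tendsto_divide) (auto simp: V_dt_0)
  ultimately have "((\<lambda>t. V \<psi> t / amp t) \<longlongrightarrow> J_dt \<psi> 0 / 1) (at_right 0)"
    by (rule lhopital_right)
  from filterlim_compose[OF this filterlim_kspeed]
  have "((\<lambda>v. V \<psi> (kspeed v) / amp (kspeed v)) \<longlongrightarrow> J_dt \<psi> 0) (at_right 0)" by simp
  then show ?thesis
    by (rule Lim_transform_eventually)
      (use eventually_at_right_0_less[OF nu_cr_pos] in \<open>auto elim!: eventually_mono simp: deriv_H \<psi>\<close>)
qed

text \<open>Here \<open>V\<close> may have a nonzero limit, so that \<open>V / amp\<close> is
  unbounded; the weight \<open>rho\<close> compensates, since \<open>rho / amp\<close> is a power of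
  \<open>1 - 2 * \<rho>^2\<close> and tends to 1.\<close>

lemma tendsto_rho_deriv_H:
  assumes \<psi>: "test_fun \<psi>"
  shows "((\<lambda>v. rho v * deriv (\<lambda>\<mu>. H \<mu> \<psi>) v) \<longlongrightarrow> J \<psi> 0 0) (at_right 0)"
proof -
  have "(rho \<longlongrightarrow> 0) (at_right 0)"
    using tendsto_at_right_0[OF continuous_on_rho nu_cr_pos] by (simp add: rho_0)
  then have "((\<lambda>v. (1 - 2 * (rho v)\<^sup>2) powr (1 / 4)) \<longlongrightarrow> (1 - 2 * 0\<^sup>2) powr (1 / 4)) (at_right 0)"
    by (intro tendsto_intros) auto
  moreover have "((\<lambda>v. V \<psi> (kspeed v)) \<longlongrightarrow> J \<psi> 0 0) (at_right 0)"
    by (rule filterlim_compose[OF tendsto_V[OF \<psi>] filterlim_kspeed])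
  ultimately have "((\<lambda>v. (1 - 2 * (rho v)\<^sup>2) powr (1 / 4) * V \<psi> (kspeed v)) \<longlongrightarrow>
      (1 - 2 * 0\<^sup>2) powr (1 / 4) * J \<psi> 0 0) (at_right 0)"
    by (rule tendsto_mult)
  then have "((\<lambda>v. (1 - 2 * (rho v)\<^sup>2) powr (1 / 4) * V \<psi> (kspeed v)) \<longlongrightarrow> J \<psi> 0 0) (at_right 0)"
    by simp
  then show ?thesis
    by (rule Lim_transform_eventually)
      (use eventually_at_right_0_less[OF nu_cr_pos] in
        \<open>auto elim!: eventually_mono simp: deriv_H \<psi> amp_kspeed(3)[symmetric]\<close>)
qed

end

section \<open>The two Cauchy data\<close>

text \<open>D'Alembert's formula for initial position 0 and velocity \<open>\<delta>_0\<close>, in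
  tested form. The time argument 0 of \<open>mean\<close> is a dummy, since the function averaged is
  constant in time.\<close>

definition velocity_data :: "(real \<Rightarrow> real) \<Rightarrow> real \<Rightarrow> real \<Rightarrow> real" where
  "velocity_data \<psi> t x = t * mean (\<lambda>_. \<psi>) 0 t x"

text \<open>D'Alembert's formula for initial position \<open>- \<delta>_0''\<close> and velocity 0,
  with both derivatives moved onto the test function.\<close>

definition position_data :: "(real \<Rightarrow> real) \<Rightarrow> real \<Rightarrow> real \<Rightarrow> real" where
  "position_data \<psi> t x = - ((deriv (deriv \<psi>) (x + t) + deriv (deriv \<psi>) (x - t)) / 2)"

lemma strip_cont_test_fun: "test_fun \<psi> \<Longrightarrow> strip_cont T (\<lambda>_. \<psi>)"
  by (intro strip_contI continuous_on_compose2[OF continuous_on_test_fun[where S = UNIV], of \<psi> _ snd])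
    (auto intro: continuous_intros)

lemma has_real_derivative_reflected_sum:
  assumes "\<And>x. (f has_real_derivative f' x) (at x)"
  shows "((\<lambda>t. (f (x + t) + f (x - t)) / 2) has_real_derivative (f' (x + t) - f' (x - t)) / 2) (at t)"
    and "((\<lambda>t. (f (x + t) - f (x - t)) / 2) has_real_derivative (f' (x + t) + f' (x - t)) / 2) (at t)"
proof -
  have 1: "((\<lambda>t. f (x + t)) has_real_derivative f' (x + t) * 1) (at t)"
    by (rule DERIV_chain2[OF assms, where g = "\<lambda>t. x + t"]) (auto intro!: derivative_eq_intros)
  have 2: "((\<lambda>t. f (x - t)) has_real_derivative f' (x - t) * (-1)) (at t)"
    by (rule DERIV_chain2[OF assms, where g = "\<lambda>t. x - t"]) (auto intro!: derivative_eq_intros)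
  show "((\<lambda>t. (f (x + t) + f (x - t)) / 2) has_real_derivative (f' (x + t) - f' (x - t)) / 2) (at t)"
    using DERIV_cdivide[OF DERIV_add[OF 1 2], of 2] by simp
  show "((\<lambda>t. (f (x + t) - f (x - t)) / 2) has_real_derivative (f' (x + t) + f' (x - t)) / 2) (at t)"
    using DERIV_cdivide[OF DERIV_diff[OF 1 2], of 2] by simp
qed

lemma deriv_deriv_add_cmult:
  assumes "test_fun \<psi>" "test_fun \<phi>"
  shows "deriv (deriv (\<lambda>x. a * \<psi> x + b * \<phi> x)) = (\<lambda>x. a * deriv (deriv \<psi>) x + b * deriv (deriv \<phi>) x)"
proof -
  have "deriv (\<lambda>x. a * \<psi> x + b * \<phi> x) = (\<lambda>x. a * deriv \<psi> x + b * deriv \<phi> x)"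
    if "test_fun \<psi>" "test_fun \<phi>" for \<psi> \<phi>
    by (rule ext, rule DERIV_imp_deriv)
      (intro DERIV_add DERIV_cmult test_fun_has_real_derivative that)
  then show ?thesis using assms by (simp add: test_fun_deriv)
qed

text \<open>The free wave starts from position 0, so the compatibility condition holds with
  \<open>c = 0\<close>.\<close>

interpretation regular: wave_data velocity_data "\<lambda>\<psi> t. (\<psi> t + \<psi> (- t)) / 2" "\<lambda>_. 0"
proof
  fix \<psi> :: "real \<Rightarrow> real" assume \<psi>: "test_fun \<psi>"
  note \<psi>' = test_fun_deriv[OF \<psi>]
  \<comment> \<open>Height 0 is enough because \<open>mean\<close> is evaluated only at the dummy
    time 0.\<close>
  note cont = strip_cont_test_fun[OF \<psi>, of 0]
  fix T :: real
  show "strip_cont T (velocity_data \<psi>)"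
    unfolding velocity_data_def[abs_def]
    by (intro strip_contI continuous_intros continuous_on_mean[OF cont]) auto
  show "((\<lambda>t. velocity_data \<psi> t 0) has_real_derivative (\<psi> t + \<psi> (- t)) / 2) (at t)" for t
    using has_real_derivative_scaled_mean[OF cont, of 0 0 t] by (simp add: velocity_data_def)
  show "(velocity_data \<psi> t has_real_derivative velocity_data (deriv \<psi>) t x) (at x)" for t x
    unfolding velocity_data_def[abs_def]
    by (intro DERIV_cmult has_real_derivative_mean[OF cont strip_cont_test_fun[OF \<psi>', of 0]]
        test_fun_has_real_derivative \<psi>) auto
  \<comment> \<open>\<open>deriv \<psi>\<close> is a primitive of the second derivative, so the
    velocity data of the latter are half a difference of \<open>deriv \<psi>\<close> at
    \<open>t\<close> and \<open>- t\<close>, as differentiating the reflected sum gives.\<close>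
  show "((\<lambda>t. (\<psi> t + \<psi> (- t)) / 2) has_real_derivative velocity_data (deriv (deriv \<psi>)) t 0) (at t)" for t
    using has_real_derivative_reflected_sum(1)[OF test_fun_has_real_derivative[OF \<psi>], of 0 t]
    unfolding velocity_data_def
      scaled_mean_eq[of 0 t "deriv \<psi>" "\<lambda>_. deriv (deriv \<psi>)" 0,
        OF test_fun_has_real_derivative[OF \<psi>']]
    by simp
  show "\<bar>velocity_data \<psi> t x\<bar> \<le> (1 + T) * c2_norm \<psi>" if t: "0 \<le> t" "t \<le> T" for t x
  proof -
    have "\<bar>mean (\<lambda>_. \<psi>) 0 t x\<bar> \<le> c2_norm \<psi>"
      by (rule abs_mean_le[OF cont]) (auto intro: abs_le_c2_norm \<psi>)
    then have "t * \<bar>mean (\<lambda>_. \<psi>) 0 t x\<bar> \<le> (1 + T) * c2_norm \<psi>"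
      using t by (intro mult_mono) auto
    then show ?thesis using t by (simp add: velocity_data_def abs_mult)
  qed
  show "velocity_data \<psi> s y = 0"
    if supp: "closure {x. \<psi> x \<noteq> 0} \<inter> {-L..L} = {}" and s: "0 \<le> s" "s + \<bar>y\<bar> \<le> L" for L s y
  proof -
    have "\<psi> (y + s * z) = 0" if z: "z \<in> {-1..1}" for z
    proof -
      have "\<bar>s * z\<bar> \<le> s * 1" unfolding abs_mult using z s by (intro mult_mono) auto
      then have "\<bar>y + s * z\<bar> \<le> L" using s by linarith
      then have "y + s * z \<in> {-L..L}" by auto
      then show ?thesis using supp closure_subset[of "{x. \<psi> x \<noteq> 0}"] by auto
    qed
    then have "integral {-1..1} (\<lambda>z. \<psi> (y + s * z)) = integral {-1..1} (\<lambda>_::real. 0)"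
      by (rule integral_cong)
    then show ?thesis by (simp add: velocity_data_def mean_def)
  qed
  show "velocity_data (\<lambda>x. a * \<psi> x + b * \<phi> x) = (\<lambda>t x. a * velocity_data \<psi> t x + b * velocity_data \<phi> t x)"
    if \<phi>: "test_fun \<phi>" for \<phi> a b
  proof (intro ext)
    fix t x
    show "velocity_data (\<lambda>x. a * \<psi> x + b * \<phi> x) t x = a * velocity_data \<psi> t x + b * velocity_data \<phi> t x"
      using mean_add_cmult[OF cont strip_cont_test_fun[OF \<phi>, of 0], of 0 a b t x]
      by (simp add: velocity_data_def algebra_simps)
  qed
  show "\<bar>0\<bar> \<le> c2_norm \<psi>" using abs_le_c2_norm(3)[OF \<psi>] by simp
  show "0 = - velocity_data \<psi> 0 0" by (simp add: velocity_data_def)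
qed simp_all

text \<open>Compatibility dictates \<open>c\<close>: at time 0 the position data are minus the
  second derivative at 0, so \<open>c\<close> has to act as evaluation at 0 on second
  derivatives.\<close>

interpretation singular: wave_data position_data
  "\<lambda>\<psi> t. - ((deriv (deriv (deriv \<psi>)) t - deriv (deriv (deriv \<psi>)) (- t)) / 2)" "\<lambda>\<psi>. \<psi> 0"
proof
  fix \<psi> :: "real \<Rightarrow> real" assume \<psi>: "test_fun \<psi>"
  define \<psi>2 where "\<psi>2 = deriv (deriv \<psi>)"
  have \<psi>2: "test_fun \<psi>2" unfolding \<psi>2_def by (intro test_fun_deriv \<psi>)
  note \<psi>3 = test_fun_deriv[OF \<psi>2]
  have eq: "position_data \<psi> = (\<lambda>t x. - ((\<psi>2 (x + t) + \<psi>2 (x - t)) / 2))"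
    by (intro ext) (simp add: position_data_def \<psi>2_def)
  fix T :: real
  show "strip_cont T (position_data \<psi>)"
    unfolding eq
    by (intro strip_contI continuous_intros continuous_on_compose2[OF continuous_on_test_fun[OF \<psi>2, of UNIV]]) auto
  show "((\<lambda>t. position_data \<psi> t 0) has_real_derivative
      - ((deriv (deriv (deriv \<psi>)) t - deriv (deriv (deriv \<psi>)) (- t)) / 2)) (at t)" for t
    using DERIV_minus[OF has_real_derivative_reflected_sum(1)[OF test_fun_has_real_derivative[OF \<psi>2], of 0 t]]
    unfolding eq by (simp add: \<psi>2_def)
  show "(position_data \<psi> t has_real_derivative position_data (deriv \<psi>) t x) (at x)" for t x
  proof -
    have "((\<lambda>x. \<psi>2 (x + t)) has_real_derivative deriv \<psi>2 (x + t)) (at x)"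
      "((\<lambda>x. \<psi>2 (x - t)) has_real_derivative deriv \<psi>2 (x - t)) (at x)"
      using iffD1[OF DERIV_shift test_fun_has_real_derivative[OF \<psi>2, of "x + t"]]
        iffD1[OF DERIV_shift test_fun_has_real_derivative[OF \<psi>2, of "x + (- t)"]]
      by simp_all
    from DERIV_minus[OF DERIV_cdivide[OF DERIV_add[OF this], of 2]] show ?thesis
      unfolding eq by (simp add: position_data_def \<psi>2_def)
  qed
  show "((\<lambda>t. - ((deriv (deriv (deriv \<psi>)) t - deriv (deriv (deriv \<psi>)) (- t)) / 2)) has_real_derivative
      position_data (deriv (deriv \<psi>)) t 0) (at t)" for t
    using DERIV_minus[OF has_real_derivative_reflected_sum(2)[OF test_fun_has_real_derivative[OF \<psi>3], of 0 t]]
    by (simp add: \<psi>2_def position_data_def)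
  show "\<bar>position_data \<psi> t x\<bar> \<le> (1 + T) * c2_norm \<psi>" if t: "0 \<le> t" "t \<le> T" for t x
  proof -
    have "\<bar>position_data \<psi> t x\<bar> \<le> 1 * c2_norm \<psi>"
      using abs_le_c2_norm(2)[OF \<psi>, of "x + t"] abs_le_c2_norm(2)[OF \<psi>, of "x - t"]
      unfolding position_data_def abs_le_iff by (simp add: field_simps)
    also have "\<dots> \<le> (1 + T) * c2_norm \<psi>"
      using t abs_le_c2_norm(3)[OF \<psi>] by (intro mult_right_mono) auto
    finally show ?thesis .
  qed
  show "position_data \<psi> s y = 0"
    if supp: "closure {x. \<psi> x \<noteq> 0} \<inter> {-L..L} = {}" and s: "0 \<le> s" "s + \<bar>y\<bar> \<le> L" for L s y
  proof -
    have "closure {x. \<psi>2 x \<noteq> 0} \<subseteq> closure {x. \<psi> x \<noteq> 0}"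
      unfolding \<psi>2_def using closure_deriv_nonzero_subset[of "deriv \<psi>"] closure_deriv_nonzero_subset[of \<psi>]
      by simp
    then have "\<psi>2 x = 0" if "x \<in> {-L..L}" for x
      using supp that closure_subset[of "{x. \<psi>2 x \<noteq> 0}"] by blast
    moreover have "y + s \<in> {-L..L}" "y - s \<in> {-L..L}" using s by auto
    ultimately show ?thesis by (simp add: eq)
  qed
  show "position_data (\<lambda>x. a * \<psi> x + b * \<phi> x) = (\<lambda>t x. a * position_data \<psi> t x + b * position_data \<phi> t x)"
    if \<phi>: "test_fun \<phi>" for \<phi> a b
    by (intro ext) (simp add: position_data_def deriv_deriv_add_cmult[OF \<psi> \<phi>] field_simps)
  show "\<bar>\<psi> 0\<bar> \<le> c2_norm \<psi>" by (rule abs_le_c2_norm(1)[OF \<psi>])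
  show "deriv (deriv \<psi>) 0 = - position_data \<psi> 0 0" by (simp add: position_data_def)
qed simp_all

theorem theorem2p1:
  shows "\<exists>Hr Hs.
     cone_wave_solution Hr \<and>
     (\<forall>\<psi>. test_fun \<psi> \<longrightarrow>
        ((\<lambda>v. Hr v \<psi>) \<longlongrightarrow> 0) (at_right 0) \<and>
        ((\<lambda>v. deriv (\<lambda>\<mu>. Hr \<mu> \<psi>) v) \<longlongrightarrow> \<psi> 0) (at_right 0)) \<and>
     cone_wave_solution Hs \<and>
     (\<forall>\<psi>. test_fun \<psi> \<longrightarrow>
        ((\<lambda>v. Hs v \<psi>) \<longlongrightarrow> \<psi> 0) (at_right 0) \<and>
        ((\<lambda>v. rho v * deriv (\<lambda>\<mu>. Hs \<mu> \<psi>) v) \<longlongrightarrow> - deriv (deriv \<psi>) 0) (at_right 0))"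
proof (intro exI conjI allI impI)
  show "cone_wave_solution regular.H" by (rule regular.cone_wave_solution_H)
  show "cone_wave_solution singular.H" by (rule singular.cone_wave_solution_H)
  fix \<psi> assume \<psi>: "test_fun \<psi>"
  show "((\<lambda>v. regular.H v \<psi>) \<longlongrightarrow> 0) (at_right 0)" by (rule regular.tendsto_H[OF \<psi>])
  \<comment> \<open>The vanishing of \<open>J\<close> at time 0 required for the limit comes from
    the prefactor \<open>t\<close> in \<open>velocity_data\<close>; the average of
    \<open>\<psi> t\<close> and \<open>\<psi> (- t)\<close> is \<open>\<psi> 0\<close> at time
    0.\<close>
  show "((\<lambda>v. deriv (\<lambda>\<mu>. regular.H \<mu> \<psi>) v) \<longlongrightarrow> \<psi> 0) (at_right 0)"
    using regular.tendsto_deriv_H[OF \<psi>] by (simp add: velocity_data_def)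
  show "((\<lambda>v. singular.H v \<psi>) \<longlongrightarrow> \<psi> 0) (at_right 0)" by (rule singular.tendsto_H[OF \<psi>])
  show "((\<lambda>v. rho v * deriv (\<lambda>\<mu>. singular.H \<mu> \<psi>) v) \<longlongrightarrow> - deriv (deriv \<psi>) 0) (at_right 0)"
    using singular.tendsto_rho_deriv_H[OF \<psi>] by (simp add: position_data_def)
qed

end
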